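(* Let $\mathrm{Co}_1$ be Conway's simple group in its primitive permutation action of degree $98280$ on the set $\Omega$ of cosets of $\mathrm{Co}_2$, and let $C_{24}$ be the binary two-weight code of length $98280$ given by a $24$-dimensional submodule of the permutation module $\mathbb{F}_2\Omega$. Let $\Gamma(C_{24})$ be the graph whose vertices are the codewords of $C_{24}$, two codewords $x,y$ being adjacent if and only if their Hamming distance $d(x,y)$ equals $w_1$, the smaller of the two non-zero weights of $C_{24}$. Then $\Gamma(C_{24})$ is a strongly regular $(16777216, 98280, 4600, 552)$ graph with spectrum $[98280]^{1},[4072]^{98280},[-24]^{16678935}$. The complementary graph $\overline{\Gamma(C_{24})}$ of $\Gamma(C_{24})$ is a strongly regular $(16777216, 16678935, 16581206, 16585256)$ graph with spectrum $[16678935]^{1},[23]^{16678935},[-4073]^{98280}$.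
   Context: Groups. Let $\Lambda\subset\mathbb{R}^{24}$ be the Leech lattice and $\mathrm{Aut}(\Lambda)$ its group of isometries fixing the origin. $\mathrm{Co}_1=\mathrm{Aut}(\Lambda)/\langle -1\rangle$. $\mathrm{Co}_2$ is the stabilizer in $\mathrm{Aut}(\Lambda)$ of a minimal non-zero vector of $\Lambda$; it embeds in $\mathrm{Co}_1$ as a maximal subgroup of index $98280$. The action of $\mathrm{Co}_1$ on the cosets of $\mathrm{Co}_2$ is equivalent to its action on the $98280$ pairs $\{\pm v\}$ of minimal vectors of $\Lambda$. Modules and codes. $\mathbb{F}_2\Omega$ is the $\mathbb{F}_2$-vector space with basis $\Omega$, on which $\mathrm{Co}_1$ acts linearly by permuting the basis; subspaces are identified with binary linear codes with coordinate positions indexed by $\Omega$. A two-weight code is one in which exactly two non-zero values $w_1<w_2$ occur as weights of codewords; for $C_{24}$ these are $w_1=47104$ and $w_2=49152$. Graphs. A strongly regular $(v,k,\lambda,\mu)$ graph is a $k$-regular graph on $v$ vertices in which any two adjacent vertices have exactly $\lambda$ common neighbours and any two distinct non-adjacent vertices have exactly $\mu$ common neighbours. The spectrum is that of the adjacency matrix; $[\theta]^{f}$ means that $\theta$ is an eigenvalue with multiplicity $f$. *)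

theory Defs
  imports
    "HOL-Analysis.Analysis"
    "HOL-Algebra.Generated_Groups"
    "HOL-Algebra.Left_Coset"
    "HOL-Library.Z2"
    "HOL-Library.Function_Algebras"
    "Jordan_Normal_Form.Spectral_Radius"
begin

section \<open>The Leech lattice\<close>

text \<open>
  The 24 coordinates are labelled by the projective line over the field with 23 elements:
  \<open>Some a\<close> for the residue class \<open>a\<close> modulo 23, and \<open>None\<close> for the point at infinity.
\<close>

type_synonym PL23 = "23 option"
type_synonym R24 = "real ^ PL23"

text \<open>
  The extended binary Golay code as the extended quadratic residue code modulo 23.  Codewords are
  identified with their supports.  Generators are the translates of the set
  consisting of infinity and the non-residues, together with the whole projective line;
  the sum of a family of generators consists of the points
  covered an odd number of times.
\<close>

fun golay_generator :: "PL23 \<Rightarrow> PL23 set" where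
  "golay_generator None = UNIV"
| "golay_generator (Some a) = insert None {Some (n - a) |n. \<not> (\<exists>x. n = x\<^sup>2)}"

definition golay_code :: "PL23 set set" where
  "golay_code = {S. \<exists>J. S = {i. odd (card {j \<in> J. i \<in> golay_generator j})}}"

text \<open>Conway's coordinates, scaled so that the lattice is even and unimodular.\<close>

definition leech_lattice :: "R24 set" where
  "leech_lattice = {(\<chi> i. of_int (z i) / sqrt 8) |z :: PL23 \<Rightarrow> int.
     \<exists>m :: int. (\<forall>i. z i mod 2 = m mod 2) \<and>
                (\<Sum>i\<in>UNIV. z i) mod 8 = (4 * m) mod 8 \<and>
                (\<forall>k. {i. z i mod 4 = k mod 4} \<in> golay_code)}"

definition minimal_vectors :: "'a::real_normed_vector set \<Rightarrow> 'a set" where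
  "minimal_vectors L = {v \<in> L. v \<noteq> 0 \<and> (\<forall>u\<in>L. u \<noteq> 0 \<longrightarrow> norm v \<le> norm u)}"


section \<open>Conway's groups\<close>

definition Aut_Leech :: "(R24 \<Rightarrow> R24) monoid" where
  "Aut_Leech = \<lparr>carrier = {f. orthogonal_transformation f \<and> f ` leech_lattice = leech_lattice},
                mult = (\<circ>), one = id\<rparr>"

definition minus_one :: "(R24 \<Rightarrow> R24) set" where
  "minus_one = generate Aut_Leech {uminus}"

definition Co1 :: "(R24 \<Rightarrow> R24) set monoid" where
  "Co1 = Aut_Leech Mod minus_one"

definition Co2 :: "R24 \<Rightarrow> (R24 \<Rightarrow> R24) set" where
  "Co2 v = {f \<in> carrier Aut_Leech. f v = v}"

text \<open>The subgroup \<open>Co2 v\<close> of \<open>Aut_Leech\<close>, viewed inside \<open>Co1\<close>.\<close>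

definition Co2_in_Co1 :: "R24 \<Rightarrow> (R24 \<Rightarrow> R24) set set" where
  "Co2_in_Co1 v = (\<lambda>f. minus_one #>\<^bsub>Aut_Leech\<^esub> f) ` Co2 v"

definition Omega :: "R24 \<Rightarrow> (R24 \<Rightarrow> R24) set set set" where
  "Omega v = lcosets\<^bsub>Co1\<^esub> (Co2_in_Co1 v)"

definition Co1_action ::
  "(R24 \<Rightarrow> R24) set \<Rightarrow> (R24 \<Rightarrow> R24) set set \<Rightarrow> (R24 \<Rightarrow> R24) set set" where
  "Co1_action g \<omega> = g <#\<^bsub>Co1\<^esub> \<omega>"


section \<open>Permutation modules and binary codes\<close>

global_interpretation F2: vector_space "\<lambda>(a::bit) (c::'w \<Rightarrow> bit). (\<lambda>\<omega>. a * c \<omega>)"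
  defines F2_subspace = F2.subspace and F2_dim = F2.dim
  by unfold_locales (auto simp: fun_eq_iff algebra_simps)

text \<open>
  The vector space with basis \<open>\<Omega>\<close>: finitely supported functions, the basis vector belonging
  to a point of \<open>\<Omega>\<close> being its indicator function.
\<close>

definition F2_space :: "'w set \<Rightarrow> ('w \<Rightarrow> bit) set" where
  "F2_space \<Omega> = {c. finite {\<omega>. c \<omega> \<noteq> 0} \<and> {\<omega>. c \<omega> \<noteq> 0} \<subseteq> \<Omega>}"

text \<open>
  Linear extension of the permutation of the basis: the coefficient of \<open>g c\<close> at \<open>\<omega>\<close> is that of
  \<open>c\<close> at the preimage of \<open>\<omega>\<close> under \<open>g\<close>.
\<close>

definition permute_word ::
  "('g, 'b) monoid_scheme \<Rightarrow> ('g \<Rightarrow> 'w \<Rightarrow> 'w) \<Rightarrow> 'w set \<Rightarrow> 'g \<Rightarrow> ('w \<Rightarrow> bit) \<Rightarrow> ('w \<Rightarrow> bit)" where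
  "permute_word G act \<Omega> g c = (\<lambda>\<omega>. if \<omega> \<in> \<Omega> then c (act (inv\<^bsub>G\<^esub> g) \<omega>) else 0)"

definition permutation_submodule ::
  "('g, 'b) monoid_scheme \<Rightarrow> ('g \<Rightarrow> 'w \<Rightarrow> 'w) \<Rightarrow> 'w set \<Rightarrow> ('w \<Rightarrow> bit) set \<Rightarrow> bool" where
  "permutation_submodule G act \<Omega> C \<longleftrightarrow>
     C \<subseteq> F2_space \<Omega> \<and> F2_subspace C \<and> (\<forall>g\<in>carrier G. \<forall>c\<in>C. permute_word G act \<Omega> g c \<in> C)"

definition weight :: "('w \<Rightarrow> bit) \<Rightarrow> nat" where
  "weight c = card {\<omega>. c \<omega> \<noteq> 0}"

definition hamming_distance :: "('w \<Rightarrow> bit) \<Rightarrow> ('w \<Rightarrow> bit) \<Rightarrow> nat" where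
  "hamming_distance x y = card {\<omega>. x \<omega> \<noteq> y \<omega>}"

definition two_weight_code :: "('w \<Rightarrow> bit) set \<Rightarrow> nat \<Rightarrow> nat \<Rightarrow> bool" where
  "two_weight_code C w1 w2 \<longleftrightarrow> w1 < w2 \<and> weight ` C - {0} = {w1, w2}"


section \<open>Graphs\<close>

text \<open>A graph is given by its vertex set and its adjacency relation.\<close>

type_synonym 'a graph = "'a set \<times> ('a \<Rightarrow> 'a \<Rightarrow> bool)"

definition code_graph :: "('w \<Rightarrow> bit) set \<Rightarrow> nat \<Rightarrow> ('w \<Rightarrow> bit) graph" where
  "code_graph C w1 = (C, \<lambda>x y. hamming_distance x y = w1)"

definition complement_graph :: "'a graph \<Rightarrow> 'a graph" where
  "complement_graph = (\<lambda>(V, E). (V, \<lambda>x y. x \<noteq> y \<and> \<not> E x y))"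

definition simple_graph :: "'a graph \<Rightarrow> bool" where
  "simple_graph = (\<lambda>(V, E). finite V \<and> (\<forall>x\<in>V. \<not> E x x) \<and> (\<forall>x\<in>V. \<forall>y\<in>V. E x y \<longrightarrow> E y x))"

definition strongly_regular :: "'a graph \<Rightarrow> nat \<Rightarrow> nat \<Rightarrow> nat \<Rightarrow> nat \<Rightarrow> bool" where
  "strongly_regular = (\<lambda>(V, E) v k l m.
     simple_graph (V, E) \<and> card V = v \<and>
     (\<forall>x\<in>V. card {y \<in> V. E x y} = k) \<and>
     (\<forall>x\<in>V. \<forall>y\<in>V. E x y \<longrightarrow> card {z \<in> V. E x z \<and> E y z} = l) \<and>
     (\<forall>x\<in>V. \<forall>y\<in>V. x \<noteq> y \<and> \<not> E x y \<longrightarrow> card {z \<in> V. E x z \<and> E y z} = m))"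

text \<open>The adjacency matrix depends on an enumeration \<open>vs\<close> of the vertices.\<close>

definition adjacency_matrix :: "'a list \<Rightarrow> ('a \<Rightarrow> 'a \<Rightarrow> bool) \<Rightarrow> complex mat" where
  "adjacency_matrix vs E =
     Matrix.mat (length vs) (length vs) (\<lambda>(i, j). if E (vs ! i) (vs ! j) then 1 else 0)"

text \<open>
  \<open>has_spectrum \<Gamma> S\<close>: the eigenvalues are exactly the first components of \<open>S\<close>, and each pair
  \<open>(\<theta>, f)\<close> in \<open>S\<close> gives an eigenvalue with its multiplicity as a root of the characteristic
  polynomial (the multiplicity is algebraic; the adjacency matrix of a simple graph is real
  symmetric, so this is also the dimension of the eigenspace).
\<close>

definition has_spectrum :: "'a graph \<Rightarrow> (complex \<times> nat) set \<Rightarrow> bool" where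
  "has_spectrum = (\<lambda>(V, E) S.
     finite V \<and>
     (\<forall>vs. distinct vs \<and> set vs = V \<longrightarrow>
        spectrum (adjacency_matrix vs E) = fst ` S \<and>
        (\<forall>(\<theta>, f)\<in>S. Polynomial.order \<theta> (char_poly (adjacency_matrix vs E)) = f)))"

end

theory Submission
  imports Defs
begin

text \<open>
  Write \<open>n\<close> for the number of points of \<open>\<Omega>\<close> and put \<open>s(c) = \<Sum>\<^sub>\<omega> (-1)\<^bsup>c(\<omega>)\<^esup>\<close>, which is
  \<open>n - 2 weight(c)\<close>.  Every coordinate \<open>\<omega>\<close> defines a character \<open>c \<mapsto> (-1)\<^bsup>c(\<omega>)\<^esup>\<close> of the group \<open>C\<close>,
  so \<open>s\<close> is a sum of characters and orthogonality determines its autocorrelation.  On the other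
  hand \<open>s\<close> takes only two values on the nonzero words, hence the indicator function of the words of
  weight \<open>w1\<close> is an affine function of \<open>s\<close>, up to a correction at the zero word.  If no two coordinates
  carry the same character, the autocorrelation of \<open>s\<close> is a multiple of \<open>s\<close>, and the number of
  ways to write a word \<open>d\<close> as a sum of two words of weight \<open>w1\<close> depends only on the weight of \<open>d\<close>
  (\<open>common_light_words\<close>).  The graph is the Cayley graph of \<open>C\<close> on these words, so this is
  strong regularity.

  It remains to see that \<open>n = 98280\<close> and that the coordinates carry different characters.  Since
  \<open>Co\<^sub>1\<close> permutes \<open>\<Omega>\<close> transitively and preserves \<open>C\<close>, no coordinate is constantly zero and every
  character occurs equally often, say \<open>m\<close> times.  The first two moments of \<open>s\<close> then give, with
  \<open>t = 98304 - n\<close>, the equation \<open>m (98304 - t) = 552 + 4096 t - t\<^sup>2\<close> with \<open>1 \<le> t \<le> 4096\<close>.  Its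
  discriminant is a perfect square only for \<open>m = 1\<close>, which leaves \<open>n = 98280\<close> and \<open>n = 94231\<close>
  (\<open>length_from_moments\<close>).  Parity decides between the two:
  \<open>n\<close> is even (\<open>even_card_Omega\<close>).  The sign changes on Golay codewords are commuting involutions
  in \<open>Aut(\<Lambda>)\<close>, and a point of \<open>\<Omega>\<close> fixed by all of them would give a minimal vector that every
  such sign change maps to itself or to its negative.  The Golay code separates the 24 coordinates, so
  this vector would have a single nonzero entry; but a lattice vector of that shape is longer than
  \<open>(4, 4, 0, \<dots>, 0) / \<surd>8\<close>.

  The spectrum follows from strong regularity alone: the three eigenvalues come from the
  quadratic equation for the adjacency matrix \<open>A\<close>, and their algebraic multiplicities are the
  solution of a Vandermonde system given by the size and the traces of \<open>A\<close> and \<open>A\<^sup>2\<close>.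
\<close>

section \<open>Strongly regular graphs\<close>

text \<open>
  Two closed neighbourhoods, or two open ones, are removed from the vertex set; the sizes are
  inclusion--exclusion. Adjacent vertices of the complement are the non-adjacent ones of the
  graph, so the parameters \<open>l\<close> and \<open>m\<close> change places.
\<close>

lemma strongly_regular_complement:
  assumes "strongly_regular G v k l m"
  shows "strongly_regular (complement_graph G) v (v - 1 - k) (v - 2 - (2 * k - m)) (v - (2 * k - l))"
proof -
  obtain V E where G: "G = (V, E)" by fastforce
  define N where "N x = {y \<in> V. E x y}" for x
  have NN: "N x \<inter> N y = {z \<in> V. E x z \<and> E y z}" for x y by (auto simp: N_def)
  from assms have fin: "finite V" and irr: "\<And>x. x \<in> V \<Longrightarrow> \<not> E x x"
    and sym: "\<And>x y. x \<in> V \<Longrightarrow> y \<in> V \<Longrightarrow> E x y \<Longrightarrow> E y x"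
    and v: "card V = v" and k: "\<And>x. x \<in> V \<Longrightarrow> card (N x) = k"
    and l: "\<And>x y. x \<in> V \<Longrightarrow> y \<in> V \<Longrightarrow> E x y \<Longrightarrow> card (N x \<inter> N y) = l"
    and m: "\<And>x y. x \<in> V \<Longrightarrow> y \<in> V \<Longrightarrow> x \<noteq> y \<Longrightarrow> \<not> E x y \<Longrightarrow> card (N x \<inter> N y) = m"
    unfolding NN unfolding G strongly_regular_def simple_graph_def N_def by simp_all
  have finN: "finite (N x)" and NV: "N x \<subseteq> V" for x
    using fin by (auto simp: N_def)
  have un: "card (N x \<union> N y) = 2 * k - card (N x \<inter> N y)" if "x \<in> V" "y \<in> V" for x y
    using card_Un_Int[OF finN finN, of x y] k that by simp
  have deg: "card {y \<in> V. x \<noteq> y \<and> \<not> E x y} = v - 1 - k" if x: "x \<in> V" for x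
  proof -
    have "{y \<in> V. x \<noteq> y \<and> \<not> E x y} = V - insert x (N x)" by (auto simp: N_def)
    moreover have "card (insert x (N x)) = Suc k"
      using irr[OF x] finN k[OF x] by (simp add: N_def)
    ultimately show ?thesis
      using card_Diff_subset[of "insert x (N x)" V] finN NV x v by simp
  qed
  have adj: "card {z \<in> V. (x \<noteq> z \<and> \<not> E x z) \<and> y \<noteq> z \<and> \<not> E y z} = v - 2 - (2 * k - m)"
    if x: "x \<in> V" and y: "y \<in> V" and xy: "x \<noteq> y" "\<not> E x y" for x y
  proof -
    have "{z \<in> V. (x \<noteq> z \<and> \<not> E x z) \<and> y \<noteq> z \<and> \<not> E y z} = V - ({x, y} \<union> (N x \<union> N y))"
      by (auto simp: N_def)
    moreover have "card ({x, y} \<union> (N x \<union> N y)) = 2 + (2 * k - m)"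
    proof -
      have "{x, y} \<inter> (N x \<union> N y) = {}" using irr sym x y xy by (auto simp: N_def)
      then show ?thesis using card_Un_disjoint[of "{x, y}" "N x \<union> N y"] finN un[OF x y] m[OF x y xy] xy
        by simp
    qed
    ultimately show ?thesis
      using card_Diff_subset[of "{x, y} \<union> (N x \<union> N y)" V] finN NV x y v by simp
  qed
  have nonadj: "card {z \<in> V. (x \<noteq> z \<and> \<not> E x z) \<and> y \<noteq> z \<and> \<not> E y z} = v - (2 * k - l)"
    if x: "x \<in> V" and y: "y \<in> V" and xy: "E x y" for x y
  proof -
    have "{z \<in> V. (x \<noteq> z \<and> \<not> E x z) \<and> y \<noteq> z \<and> \<not> E y z} = V - (N x \<union> N y)"
      using sym[OF x y xy] xy by (auto simp: N_def)
    then show ?thesis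
      using card_Diff_subset[of "N x \<union> N y" V] finN NV v un[OF x y] l[OF x y xy] by simp
  qed
  show ?thesis
    using fin sym v deg adj nonadj
    unfolding G complement_graph_def strongly_regular_def simple_graph_def by simp blast
qed

lemma sum_diag_mult_comm:
  fixes A B :: "'a::comm_semiring_0 mat"
  assumes "A \<in> carrier_mat n n" "B \<in> carrier_mat n n"
  shows "(\<Sum>i<n. (A * B) $$ (i, i)) = (\<Sum>i<n. (B * A) $$ (i, i))"
proof -
  have "(\<Sum>i<n. (A * B) $$ (i, i)) = (\<Sum>i<n. \<Sum>j<n. A $$ (i, j) * B $$ (j, i))"
    using assms by (auto simp: scalar_prod_def lessThan_atLeast0 intro!: sum.cong)
  also have "\<dots> = (\<Sum>j<n. \<Sum>i<n. B $$ (j, i) * A $$ (i, j))"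
    by (subst sum.swap) (simp add: mult.commute)
  also have "\<dots> = (\<Sum>i<n. (B * A) $$ (i, i))"
    using assms by (auto simp: scalar_prod_def lessThan_atLeast0 intro!: sum.cong)
  finally show ?thesis .
qed

text \<open>
  Upper triangular form \<open>A = P B Q\<close> with \<open>Q P = 1\<close>: the roots of the
  characteristic polynomial are the diagonal entries of \<open>B\<close>, their squares are the
  diagonal entries of \<open>B\<^sup>2\<close>, and the trace is invariant under conjugation.
\<close>

lemma eigenvalue_power_sums:
  fixes A :: "complex mat"
  assumes A: "A \<in> carrier_mat n n" and es: "char_poly A = (\<Prod>e\<leftarrow>es. [:- e, 1:])"
  shows "(\<Sum>e\<leftarrow>es. e) = (\<Sum>i<n. A $$ (i, i))"
    and "(\<Sum>e\<leftarrow>es. e\<^sup>2) = (\<Sum>i<n. (A * A) $$ (i, i))"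
proof -
  obtain B P Q where "schur_decomposition A es = (B, P, Q)" by (cases "schur_decomposition A es")
  from schur_decomposition[OF A es this]
  have w: "similar_mat_wit A B P Q" and ut: "upper_triangular B" and d: "diag_mat B = es" by auto
  note W = similar_mat_witD2[OF A w]
  have PBQ: "P * (B * Q) = A" using W(3-7) by (simp add: assoc_mult_mat[of _ n n _ n _ n])
  have QPM: "Q * (P * M) = M" if "M \<in> carrier_mat n n" for M
    using W(2) assoc_mult_mat[OF W(7) W(6) that] left_mult_one_mat[OF that] by simp
  have QP: "(M * Q) * P = M" if "M \<in> carrier_mat n n" for M
    using W(2) assoc_mult_mat[OF that W(7) W(6)] right_mult_one_mat[OF that] by simp
  have sum_es: "(\<Sum>e\<leftarrow>es. f e) = (\<Sum>i<n. f (B $$ (i, i)))" for f :: "complex \<Rightarrow> complex"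
    using W(5) unfolding d[symmetric] diag_mat_def
    by (simp add: interv_sum_list_conv_sum_set_nat lessThan_atLeast0 comp_def)
  have "(\<Sum>i<n. A $$ (i, i)) = (\<Sum>i<n. ((B * Q) * P) $$ (i, i))"
    using sum_diag_mult_comm[of P n "B * Q"] W(4-7) unfolding PBQ by simp
  then show "(\<Sum>e\<leftarrow>es. e) = (\<Sum>i<n. A $$ (i, i))"
    using sum_es[of "\<lambda>e. e"] QP[OF W(5)] by simp
  have "A * A = P * ((B * B) * Q)"
  proof -
    have "A * A = P * (B * (Q * (P * (B * Q))))"
      using W(4-7) by (simp add: PBQ[symmetric] assoc_mult_mat[of _ n n _ n _ n])
    also have "\<dots> = P * ((B * B) * Q)"
      using W(4-7) by (simp add: QPM assoc_mult_mat[of _ n n _ n _ n])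
    finally show ?thesis .
  qed
  then have "(\<Sum>i<n. (A * A) $$ (i, i)) = (\<Sum>i<n. (B * B) $$ (i, i))"
    using sum_diag_mult_comm[of P n "(B * B) * Q"] W(4-7) QP[of "B * B"]
    by (simp del: index_mult_mat)
  also have "\<dots> = (\<Sum>i<n. (B $$ (i, i))\<^sup>2)"
  proof (rule sum.cong)
    fix i assume "i \<in> {..<n}"
    then have i: "i < n" by simp
    have "(B * B) $$ (i, i) = (\<Sum>j<n. B $$ (i, j) * B $$ (j, i))"
      using W(5) i by (simp add: scalar_prod_def lessThan_atLeast0)
    also have "\<dots> = (\<Sum>j\<in>{i}. B $$ (i, j) * B $$ (j, i))"
      using i W(5) upper_triangularD[OF ut]
      by (intro sum.mono_neutral_right) (auto, metis carrier_matD(1) linorder_neqE_nat)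
    finally show "(B * B) $$ (i, i) = (B $$ (i, i))\<^sup>2" by (simp add: power2_eq_square)
  qed simp
  finally show "(\<Sum>e\<leftarrow>es. e\<^sup>2) = (\<Sum>i<n. (A * A) $$ (i, i))"
    using sum_es[of "\<lambda>e. e\<^sup>2"] by simp
qed

lemma order_prod_linear_factors:
  fixes es :: "'a::idom list"
  shows "Polynomial.order a (\<Prod>e\<leftarrow>es. [:- e, 1:]) = count_list es a"
proof (induction es)
  case (Cons e es)
  have nz: "(\<Prod>e\<leftarrow>es. [:- e, 1:]) \<noteq> 0" by (auto simp: prod_list_zero_iff)
  have "Polynomial.order a [:- e, 1:] = (if e = a then 1 else 0)"
    using order_power_n_n[of a 1] by (auto intro!: order_0I)
  moreover have "Polynomial.order a ([:- e, 1:] * (\<Prod>e\<leftarrow>es. [:- e, 1:])) =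
      Polynomial.order a [:- e, 1:] + Polynomial.order a (\<Prod>e\<leftarrow>es. [:- e, 1:])"
    using nz by (intro order_mult) (simp add: no_zero_divisors del: mult_pCons_left)
  ultimately show ?case using Cons by (simp del: mult_pCons_left)
qed (auto intro!: order_0I)

text \<open>
  The combination that eliminates \<open>y\<close> and \<open>z\<close> is evaluation of the
  polynomial \<open>(X - q)(X - r)\<close>.
\<close>

lemma vandermonde_3:
  fixes x y z p q r :: "'a::idom"
  assumes "x + y + z = 0" "x * p + y * q + z * r = 0" "x * p\<^sup>2 + y * q\<^sup>2 + z * r\<^sup>2 = 0"
    and "p \<noteq> q" "p \<noteq> r"
  shows "x = 0"
proof -
  have "x * ((p - q) * (p - r)) = (x * p\<^sup>2 + y * q\<^sup>2 + z * r\<^sup>2)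
      - (q + r) * (x * p + y * q + z * r) + q * r * (x + y + z)"
    by (simp add: power2_eq_square algebra_simps)
  then show ?thesis using assms by simp
qed

text \<open>
  Strong regularity says \<open>A\<^sup>2 = m J + (l - m) A + (k - m) I\<close>. An eigenvector
  whose entries sum to \<open>0\<close> is killed by \<open>J\<close>, so its eigenvalue is a
  root of the quadratic with roots \<open>\<theta>\<close> and \<open>\<tau>\<close>; otherwise
  comparing entry sums shows that the eigenvalue is \<open>k\<close>. The number of vertices and
  the traces of \<open>A\<close> and \<open>A\<^sup>2\<close> then fix the three algebraic
  multiplicities.
\<close>

lemma strongly_regular_has_spectrum:
  fixes \<theta> \<tau> :: int
  assumes srg: "strongly_regular G v k l m"
    and roots: "\<theta> + \<tau> = int l - int m" "\<theta> * \<tau> = int m - int k"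
    and distinct: "\<theta> \<noteq> int k" "\<tau> \<noteq> int k" "\<theta> \<noteq> \<tau>"
    and moments: "v = 1 + f + g" "int k + int f * \<theta> + int g * \<tau> = 0"
      "(int k)\<^sup>2 + int f * \<theta>\<^sup>2 + int g * \<tau>\<^sup>2 = int v * int k"
    and pos: "0 < f" "0 < g"
  shows "has_spectrum G {(of_nat k, 1), (of_int \<theta>, f), (of_int \<tau>, g)}"
proof -
  obtain V E where G: "G = (V, E)" by fastforce
  from srg have fin: "finite V" and irr: "\<And>x. x \<in> V \<Longrightarrow> \<not> E x x"
    and sym: "\<And>x y. x \<in> V \<Longrightarrow> y \<in> V \<Longrightarrow> E x y \<Longrightarrow> E y x"
    and v: "card V = v" and k: "\<And>x. x \<in> V \<Longrightarrow> card {y \<in> V. E x y} = k"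
    and l: "\<And>x y. x \<in> V \<Longrightarrow> y \<in> V \<Longrightarrow> E x y \<Longrightarrow> card {z \<in> V. E x z \<and> E y z} = l"
    and m: "\<And>x y. x \<in> V \<Longrightarrow> y \<in> V \<Longrightarrow> x \<noteq> y \<Longrightarrow> \<not> E x y \<Longrightarrow> card {z \<in> V. E x z \<and> E y z} = m"
    unfolding G strongly_regular_def simple_graph_def by simp_all
  let ?K = "of_nat k :: complex" and ?T = "of_int \<theta> :: complex" and ?U = "of_int \<tau> :: complex"
  have dist: "?K \<noteq> ?T" "?K \<noteq> ?U" "?T \<noteq> ?U"
    using distinct by (metis of_int_eq_iff of_int_of_nat_eq)+
  have "spectrum (adjacency_matrix vs E) = {?K, ?T, ?U} \<and>
        Polynomial.order ?K (char_poly (adjacency_matrix vs E)) = 1 \<and>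
        Polynomial.order ?T (char_poly (adjacency_matrix vs E)) = f \<and>
        Polynomial.order ?U (char_poly (adjacency_matrix vs E)) = g"
    if vs: "distinct vs" "set vs = V" for vs
  proof -
    define A where "A = adjacency_matrix vs E"
    have len: "length vs = v" using vs v by (metis distinct_card)
    have A: "A \<in> carrier_mat v v" by (simp add: A_def adjacency_matrix_def len)
    have Aij: "A $$ (i, j) = (if E (vs ! i) (vs ! j) then 1 else 0)" if "i < v" "j < v" for i j
      using that by (simp add: A_def adjacency_matrix_def len)
    have vsV: "vs ! i \<in> V" if "i < v" for i using that vs len by auto
    have reindex: "(\<Sum>i<v. h (vs ! i)) = (\<Sum>x\<in>V. h x)" for h :: "'a \<Rightarrow> complex"
      using sum.reindex_bij_betw[OF bij_betw_nth[OF vs(1) _ vs(2)[symmetric]], of "{..<v}" h] len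
      by simp
    have Asym: "A $$ (i, j) = A $$ (j, i)" if "i < v" "j < v" for i j
      using that sym[OF vsV vsV] by (auto simp: Aij)
    have row: "(\<Sum>j<v. A $$ (i, j)) = ?K" if i: "i < v" for i
    proof -
      have "(\<Sum>j<v. A $$ (i, j)) = (\<Sum>x\<in>V. if E (vs ! i) x then 1 else 0)"
        using i by (simp add: Aij flip: reindex)
      then show ?thesis using k[OF vsV[OF i]] fin by (simp add: sum.If_cases Int_def)
    qed
    have square: "(\<Sum>p<v. A $$ (i, p) * A $$ (p, j)) =
        of_nat m + of_int (int l - int m) * A $$ (i, j) + (if i = j then of_int (int k - int m) else 0)"
      if i: "i < v" and j: "j < v" for i j
    proof -
      have "(\<Sum>p<v. A $$ (i, p) * A $$ (p, j)) = (\<Sum>p<v. A $$ (i, p) * A $$ (j, p))"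
        using j Asym by simp
      also have "\<dots> = (\<Sum>z\<in>V. if E (vs ! i) z \<and> E (vs ! j) z then 1 else 0)"
        using i j by (simp add: Aij flip: reindex) (rule sum.cong, auto)
      also have "\<dots> = of_nat (card {z \<in> V. E (vs ! i) z \<and> E (vs ! j) z})"
        using fin by (simp add: sum.If_cases Int_def)
      also have "card {z \<in> V. E (vs ! i) z \<and> E (vs ! j) z} =
          (if i = j then k else if E (vs ! i) (vs ! j) then l else m)"
        using k[OF vsV[OF j]] l[OF vsV[OF i] vsV[OF j]] m[OF vsV[OF i] vsV[OF j]]
          nth_eq_iff_index_eq[OF vs(1), of i j] i j len by simp
      finally show ?thesis using irr[OF vsV[OF i]] irr[OF vsV[OF j]] i j by (simp add: Aij)
    qed
    obtain es where es: "char_poly A = (\<Prod>e\<leftarrow>es. [:- e, 1:])" and les: "length es = v"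
      using char_poly_factorized[OF A] by blast
    have spec: "spectrum A = set es"
      unfolding spectrum_root_char_poly[OF A] es
      by (auto simp: poly_prod_list prod_list_zero_iff)
    have es_sub: "set es \<subseteq> {?K, ?T, ?U}"
    proof
      fix e assume "e \<in> set es"
      then have "eigenvalue A e" using spec by (auto simp: spectrum_def)
      then obtain u where u: "u \<in> carrier_vec v" "u \<noteq> 0\<^sub>v v" "A *\<^sub>v u = e \<cdot>\<^sub>v u"
        using A unfolding eigenvalue_def eigenvector_def by auto
      have eig: "(\<Sum>j<v. A $$ (i, j) * u $ j) = e * u $ i" if "i < v" for i
        using arg_cong[OF u(3), of "\<lambda>w. w $ i"] that A u(1)
        by (simp add: scalar_prod_def lessThan_atLeast0)
      define s where "s = (\<Sum>i<v. u $ i)"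
      have "e * s = (\<Sum>i<v. \<Sum>j<v. A $$ (i, j) * u $ j)"
        by (simp add: s_def sum_distrib_left eig)
      also have "\<dots> = (\<Sum>j<v. (\<Sum>i<v. A $$ (i, j)) * u $ j)"
        by (subst sum.swap) (simp add: sum_distrib_right)
      also have "\<dots> = (\<Sum>j<v. ?K * u $ j)"
      proof (rule sum.cong)
        fix j assume "j \<in> {..<v}"
        then have "(\<Sum>i<v. A $$ (i, j)) = ?K" using Asym row[of j] by (metis (no_types, lifting) lessThan_iff sum.cong)
        then show "(\<Sum>i<v. A $$ (i, j)) * u $ j = ?K * u $ j" by simp
      qed simp
      finally have es: "e * s = ?K * s" by (simp add: s_def sum_distrib_left)
      have quad: "e\<^sup>2 * u $ i = of_nat m * s + of_int (int l - int m) * (e * u $ i) + of_int (int k - int m) * u $ i"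
        if i: "i < v" for i
      proof -
        have "e\<^sup>2 * u $ i = (\<Sum>p<v. A $$ (i, p) * (e * u $ p))"
          by (simp add: power2_eq_square eig[OF i, symmetric] sum_distrib_left mult_ac)
        also have "\<dots> = (\<Sum>p<v. \<Sum>j<v. A $$ (i, p) * A $$ (p, j) * u $ j)"
          by (simp add: eig[symmetric] sum_distrib_left mult_ac)
        also have "\<dots> = (\<Sum>j<v. (\<Sum>p<v. A $$ (i, p) * A $$ (p, j)) * u $ j)"
          by (subst sum.swap) (simp add: sum_distrib_right)
        also have "\<dots> = (\<Sum>j<v. of_nat m * u $ j + of_int (int l - int m) * (A $$ (i, j) * u $ j) +
            (if i = j then of_int (int k - int m) * u $ j else 0))"
          by (rule sum.cong) (auto simp only: square[OF i] lessThan_iff, simp add: algebra_simps)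
        also have "\<dots> = of_nat m * s + of_int (int l - int m) * (e * u $ i) + of_int (int k - int m) * u $ i"
          using i by (simp add: sum.distrib s_def sum_distrib_left[symmetric] eig)
        finally show ?thesis .
      qed
      show "e \<in> {?K, ?T, ?U}"
      proof (cases "s = 0")
        case True
        obtain i where i: "i < v" "u $ i \<noteq> 0"
          using u(1,2) by (metis carrier_vecD eq_vecI index_zero_vec(1) index_zero_vec(2))
        have "(e\<^sup>2 - of_int (int l - int m) * e - of_int (int k - int m)) * u $ i = 0"
          using quad[OF i(1)] True by (simp add: algebra_simps)
        then have "e\<^sup>2 - of_int (\<theta> + \<tau>) * e + of_int (\<theta> * \<tau>) = 0"
          unfolding roots using i(2) by simp
        then have "(e - ?T) * (e - ?U) = 0" by (simp add: power2_eq_square algebra_simps)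
        then show ?thesis by auto
      qed (use es in simp)
    qed
    define a b c where abc: "a = count_list es ?K" "b = count_list es ?T" "c = count_list es ?U"
    have sums: "(\<Sum>e\<leftarrow>es. h e) = of_nat a * h ?K + of_nat b * h ?T + of_nat c * h ?U"
      for h :: "complex \<Rightarrow> complex"
      using es_sub unfolding abc
      by (induction es) (use dist in \<open>auto simp: algebra_simps\<close>)
    have "of_nat v = (\<Sum>e\<leftarrow>es. (1::complex))" using les by (simp add: sum_list_triv)
    then have eq0: "of_nat v = (of_nat a + of_nat b + of_nat c :: complex)" by (simp add: sums)
    have eq1: "of_nat a * ?K + of_nat b * ?T + of_nat c * ?U = 0"
      using eigenvalue_power_sums(1)[OF A es] irr[OF vsV] sums[of "\<lambda>e. e"] by (simp add: Aij)
    have "(\<Sum>p<v. A $$ (i, p) * A $$ (p, i)) = ?K" if "i < v" for i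
      using square[OF that that] irr[OF vsV[OF that]] Aij[OF that that] by simp
    moreover have "(\<Sum>i<v. (A * A) $$ (i, i)) = (\<Sum>i<v. \<Sum>p<v. A $$ (i, p) * A $$ (p, i))"
      using A by (simp add: scalar_prod_def lessThan_atLeast0)
    ultimately have "(\<Sum>i<v. (A * A) $$ (i, i)) = of_nat v * ?K" by simp
    then have eq2: "of_nat a * ?K\<^sup>2 + of_nat b * ?T\<^sup>2 + of_nat c * ?U\<^sup>2 = of_nat v * ?K"
      using eigenvalue_power_sums(2)[OF A es] by (simp add: sums)
    have eqs: "of_int (int v) = (of_int (int a + int b + int c) :: complex)"
      "of_int (int a * int k + int b * \<theta> + int c * \<tau>) = (of_int 0 :: complex)"
      "of_int (int a * (int k)\<^sup>2 + int b * \<theta>\<^sup>2 + int c * \<tau>\<^sup>2) = (of_int (int v * int k) :: complex)"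
      using eq0 eq1 eq2 by simp_all
    note ieqs = eqs[unfolded of_int_eq_iff]
    \<comment> \<open>The actual multiplicities and the expected ones solve the same system.\<close>
    have lin: "(int a - 1) + (int b - int f) + (int c - int g) = 0"
      "(int a - 1) * int k + (int b - int f) * \<theta> + (int c - int g) * \<tau> = 0"
      "(int a - 1) * (int k)\<^sup>2 + (int b - int f) * \<theta>\<^sup>2 + (int c - int g) * \<tau>\<^sup>2 = 0"
      using ieqs moments by (simp_all add: left_diff_distrib)
    have "int a - 1 = 0"
      by (rule vandermonde_3[OF lin]) (use distinct in auto)
    moreover have "int b - int f = 0"
      by (rule vandermonde_3[of _ "int a - 1" "int c - int g" \<theta> "int k" \<tau>]) (use lin distinct in auto)
    moreover have "int c - int g = 0"
      by (rule vandermonde_3[of _ "int a - 1" "int b - int f" \<tau> "int k" \<theta>]) (use lin distinct in auto)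
    ultimately have abcfg: "a = 1" "b = f" "c = g" by auto
    have mem: "x \<in> set es" if "count_list es x \<noteq> 0" for x
      using that count_notin by metis
    have "set es = {?K, ?T, ?U}"
      using es_sub mem[of ?K] mem[of ?T] mem[of ?U] abcfg pos abc by auto
    then show ?thesis
      unfolding A_def[symmetric] spec using abc abcfg by (simp add: es order_prod_linear_factors)
  qed
  then show ?thesis using fin by (simp add: G has_spectrum_def)
qed

section \<open>Characters of binary codes\<close>

text \<open>
  A new basis vector \<open>b\<close> doubles the span: it adds the coset of \<open>b\<close>.
\<close>

lemma finite_card_F2_span:
  fixes B :: "('w \<Rightarrow> bit) set"
  assumes "finite B" and "\<not> F2.dependent B"
  shows "finite (F2.span B) \<and> card (F2.span B) = 2 ^ card B"
  using assms
proof (induction B)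
  case (insert b B)
  have ind: "\<not> F2.dependent B" and b: "b \<notin> F2.span B"
    using insert.prems insert.hyps(2) F2.independent_insert[of b B] by presburger+
  then have fin: "finite (F2.span B)" and card: "card (F2.span B) = 2 ^ card B" using insert by auto
  have "F2.span (insert b B) = F2.span B \<union> (+) b ` F2.span B"
  proof (rule Set.set_eqI)
    fix x :: "'w \<Rightarrow> bit"
    have "x \<in> F2.span (insert b B) \<longleftrightarrow> (\<exists>k. x - (\<lambda>\<omega>. k * b \<omega>) \<in> F2.span B)"
      unfolding F2.span_insert mem_Collect_eq ..
    also have "\<dots> \<longleftrightarrow> x \<in> F2.span B \<or> x - b \<in> F2.span B"
    proof -
      have "x - (\<lambda>\<omega>. 0 * b \<omega>) = x" "x - (\<lambda>\<omega>. 1 * b \<omega>) = x - b" by (auto simp: fun_eq_iff)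
      then show ?thesis by (metis (no_types) bit_not_one_iff)
    qed
    also have "x - b \<in> F2.span B \<longleftrightarrow> x \<in> (+) b ` F2.span B"
      by (metis (no_types, lifting) add.commute diff_add_cancel imageE image_eqI add_diff_cancel_right')
    finally show "x \<in> F2.span (insert b B) \<longleftrightarrow> x \<in> F2.span B \<union> (+) b ` F2.span B" by simp
  qed
  moreover have "F2.span B \<inter> (+) b ` F2.span B = {}"
  proof -
    have False if "x \<in> F2.span B" "y \<in> F2.span B" "x = b + y" for x y
      using F2.span_diff[OF that(1,2)] that(3) b by simp
    then show ?thesis by blast
  qed
  moreover have "card ((+) b ` F2.span B) = card (F2.span B)"
    by (rule card_image) (simp add: inj_on_def)
  ultimately show ?case using fin card insert(1,2) by (simp add: card_Un_disjoint)
next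
  case empty
  show ?case unfolding F2.span_empty by simp
qed

lemma finite_card_F2_subspace:
  fixes C :: "('w \<Rightarrow> bit) set"
  assumes "F2_subspace C" and "F2_dim C = d" and "0 < d"
  shows "finite C" and "card C = 2 ^ d"
proof -
  obtain B where B: "B \<subseteq> C" "\<not> F2.dependent B" "C \<subseteq> F2.span B" "card B = d"
    using F2.basis_exists[of C] assms(2) by metis
  then have "finite B" using assms(3) card_gt_0_iff by metis
  moreover have "F2.span B = C" using B assms(1) F2.span_minimal by blast
  ultimately show "finite C" "card C = 2 ^ d" using finite_card_F2_span B by auto
qed

definition bit_sign :: "bit \<Rightarrow> int" where
  "bit_sign b = (if b = 0 then 1 else -1)"

lemma bit_sign_add: "bit_sign (a + b) = bit_sign a * bit_sign b"
  by (cases a; cases b) (auto simp: bit_sign_def)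

lemma bit_add_eq_0: "a + b = 0 \<longleftrightarrow> a = (b :: bit)"
  by (cases a; cases b) auto

lemma bit_fun_add_self: "c + c = (0 :: 'w \<Rightarrow> bit)"
  by (simp add: fun_eq_iff)

text \<open>
  The hypothesis on the coordinates says that each of them defines a nontrivial character of the
  code.
\<close>

locale binary_code =
  fixes \<Omega> :: "'w set" and C :: "('w \<Rightarrow> bit) set"
  assumes finite_coordinates: "finite \<Omega>"
    and finite_code: "finite C"
    and subspace: "F2_subspace C"
    and supported: "C \<subseteq> F2_space \<Omega>"
    and nonzero_coordinates: "\<And>\<omega>. \<omega> \<in> \<Omega> \<Longrightarrow> \<exists>c\<in>C. c \<omega> \<noteq> 0"
begin

definition coordinate_sum :: "('w \<Rightarrow> bit) \<Rightarrow> int" where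
  "coordinate_sum c = (\<Sum>\<omega>\<in>\<Omega>. bit_sign (c \<omega>))"

definition repetitions :: "'w \<Rightarrow> 'w set" where
  "repetitions \<omega> = {\<omega>' \<in> \<Omega>. \<forall>c\<in>C. c \<omega> = c \<omega>'}"

lemma add_closed: "c \<in> C \<Longrightarrow> d \<in> C \<Longrightarrow> c + d \<in> C"
  using F2.subspace_add[OF subspace] .

lemma zero_mem: "0 \<in> C"
  using F2.subspace_0[OF subspace] by (simp add: zero_fun_def)

lemma add_bij: assumes "d \<in> C" shows "bij_betw (\<lambda>c. c + d) C C"
  by (rule bij_betw_byWitness[of _ "\<lambda>c. c + d"])
    (use assms add_closed in \<open>auto simp: add.assoc bit_fun_add_self\<close>)

lemma coordinate_sum_eq:
  assumes "c \<in> C"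
  shows "coordinate_sum c = int (card \<Omega>) - 2 * int (weight c)"
proof -
  have sub: "{\<omega>. c \<omega> \<noteq> 0} \<subseteq> \<Omega>" using assms supported by (auto simp: F2_space_def)
  have "coordinate_sum c = (\<Sum>\<omega>\<in>\<Omega>. 1 - 2 * (if c \<omega> \<noteq> 0 then 1 else 0))"
    unfolding coordinate_sum_def by (rule sum.cong) (auto simp: bit_sign_def)
  also have "\<dots> = int (card \<Omega>) - 2 * int (card (\<Omega> \<inter> {\<omega>. c \<omega> \<noteq> 0}))"
    using finite_coordinates by (simp add: sum_subtractf sum_distrib_left[symmetric] sum.If_cases)
  finally show ?thesis using sub by (simp add: weight_def Int_absorb1)
qed

lemma coordinate_sum_0: "coordinate_sum 0 = int (card \<Omega>)"
  by (simp add: coordinate_sum_def bit_sign_def)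

text \<open>
  Orthogonality with the trivial character: translation by a word \<open>d\<close> with
  \<open>\<phi> d = 1\<close> permutes the code and reverses the sign of every term.
\<close>

lemma sum_bit_sign_eq_0:
  assumes add: "\<And>c d. \<phi> (c + d) = \<phi> c + \<phi> d" and d: "d \<in> C" "\<phi> d \<noteq> 0"
  shows "(\<Sum>c\<in>C. bit_sign (\<phi> c)) = 0"
proof -
  have "(\<Sum>c\<in>C. bit_sign (\<phi> c)) = (\<Sum>c\<in>C. bit_sign (\<phi> (c + d)))"
    by (rule sum.reindex_bij_betw[OF add_bij[OF d(1)], symmetric])
  also have "\<dots> = - (\<Sum>c\<in>C. bit_sign (\<phi> c))"
  proof -
    have "bit_sign (\<phi> d) = -1" using d(2) by (simp add: bit_sign_def)
    then show ?thesis unfolding add bit_sign_add sum_negf[symmetric] by simp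
  qed
  finally show ?thesis by simp
qed

lemma sum_coordinate_sum: "(\<Sum>c\<in>C. coordinate_sum c) = 0"
proof -
  have "(\<Sum>c\<in>C. bit_sign (c \<omega>)) = 0" if "\<omega> \<in> \<Omega>" for \<omega>
    using nonzero_coordinates[OF that] sum_bit_sign_eq_0[of "\<lambda>c. c \<omega>"] by auto
  then show ?thesis unfolding coordinate_sum_def by (subst sum.swap) simp
qed

text \<open>
  After expanding both factors, the coordinates \<open>\<omega>\<close> and
  \<open>\<omega>'\<close> contribute the sum of the product of their characters over the code,
  up to the sign of \<open>d\<close> at \<open>\<omega>\<close>. This product is trivial exactly
  when \<open>\<omega>'\<close> repeats \<open>\<omega>\<close>.
\<close>

lemma correlation_coordinate_sum:
  assumes d: "d \<in> C"
  shows "(\<Sum>c\<in>C. coordinate_sum c * coordinate_sum (c + d)) = int (card C) * (\<Sum>\<omega>\<in>\<Omega>. int (card (repetitions \<omega>)) * bit_sign (d \<omega>))"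
proof -
  have orth: "(\<Sum>c\<in>C. bit_sign (c \<omega> + c \<omega>')) = (if \<omega>' \<in> repetitions \<omega> then int (card C) else 0)"
    if \<omega>': "\<omega>' \<in> \<Omega>" for \<omega> \<omega>'
  proof (cases "\<omega>' \<in> repetitions \<omega>")
    case True
    then have "(\<Sum>c\<in>C. bit_sign (c \<omega> + c \<omega>')) = (\<Sum>c\<in>C. 1)"
      by (intro sum.cong) (auto simp: repetitions_def bit_sign_def)
    then show ?thesis using True by simp
  next
    case False
    then obtain c where "c \<in> C" "c \<omega> \<noteq> c \<omega>'" using \<omega>' by (auto simp: repetitions_def)
    then have "(\<Sum>c\<in>C. bit_sign (c \<omega> + c \<omega>')) = 0"
      by (intro sum_bit_sign_eq_0[of "\<lambda>c. c \<omega> + c \<omega>'" c]) (simp_all only: plus_fun_apply ac_simps, use bit_add_eq_0 in simp_all)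
    then show ?thesis using False by simp
  qed
  have "(\<Sum>c\<in>C. coordinate_sum c * coordinate_sum (c + d)) =
      (\<Sum>c\<in>C. \<Sum>\<omega>'\<in>\<Omega>. \<Sum>\<omega>\<in>\<Omega>. bit_sign (d \<omega>) * bit_sign (c \<omega> + c \<omega>'))"
    by (simp only: coordinate_sum_def sum_product plus_fun_apply bit_sign_add mult_ac)
  also have "\<dots> = (\<Sum>\<omega>\<in>\<Omega>. bit_sign (d \<omega>) * (\<Sum>\<omega>'\<in>\<Omega>. \<Sum>c\<in>C. bit_sign (c \<omega> + c \<omega>')))"
    unfolding sum_distrib_left by (subst sum.swap, subst (2) sum.swap, subst sum.swap) simp
  also have "\<dots> = (\<Sum>\<omega>\<in>\<Omega>. bit_sign (d \<omega>) * (int (card C) * int (card (repetitions \<omega>))))"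
  proof (rule sum.cong)
    fix \<omega> assume "\<omega> \<in> \<Omega>"
    have "(\<Sum>\<omega>'\<in>\<Omega>. \<Sum>c\<in>C. bit_sign (c \<omega> + c \<omega>')) = (\<Sum>\<omega>'\<in>\<Omega>. if \<omega>' \<in> repetitions \<omega> then int (card C) else 0)"
      by (intro sum.cong refl orth)
    also have "\<dots> = int (card C) * int (card (repetitions \<omega>))"
    proof -
      have "\<Omega> \<inter> repetitions \<omega> = repetitions \<omega>" by (auto simp: repetitions_def)
      then show ?thesis using finite_coordinates by (simp add: sum.If_cases)
    qed
    finally show "bit_sign (d \<omega>) * (\<Sum>\<omega>'\<in>\<Omega>. \<Sum>c\<in>C. bit_sign (c \<omega> + c \<omega>')) =
      bit_sign (d \<omega>) * (int (card C) * int (card (repetitions \<omega>)))" by simp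
  qed simp
  finally show ?thesis by (simp add: sum_distrib_left mult_ac)
qed

text \<open>
  The number of ordered ways to write \<open>d\<close> as a sum of two words of weight
  \<open>w\<close>.
\<close>

definition common_words :: "nat \<Rightarrow> ('w \<Rightarrow> bit) \<Rightarrow> nat" where
  "common_words w d = card {c \<in> C. weight c = w \<and> weight (c + d) = w}"

lemma sum_single: "c0 \<in> C \<Longrightarrow> (\<Sum>c\<in>C. if c = c0 then (h c :: int) else 0) = h c0"
  using finite_code by (simp add: sum.delta')

context
  fixes w1 w2 :: nat
  assumes w1: "w1 \<noteq> 0" "w1 \<noteq> w2"
    and tw: "\<And>c. c \<in> C \<Longrightarrow> c \<noteq> 0 \<Longrightarrow> weight c = w1 \<or> weight c = w2"
begin

text \<open>
  The reason why two weights suffice: a two-valued function is an affine function of the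
  indicator of one of its level sets. The last term corrects the value at the zero word.
\<close>

lemma weight_indicator:
  assumes c: "c \<in> C"
  shows "2 * (int w2 - int w1) * (if weight c = w1 then 1 else 0) =
    coordinate_sum c - (int (card \<Omega>) - 2 * int w2) - (if c = 0 then 2 * int w2 else 0)"
  using w1 tw[OF c] coordinate_sum_eq[OF c] coordinate_sum_0 by (auto simp: weight_def)

lemma card_light_words:
  "2 * (int w2 - int w1) * int (card {c \<in> C. weight c = w1}) =
    - int (card C) * (int (card \<Omega>) - 2 * int w2) - 2 * int w2"
proof -
  have "int (card {c \<in> C. weight c = w1}) = (\<Sum>c\<in>C. if weight c = w1 then 1 else 0)"
    using finite_code by (simp add: sum.If_cases Int_def)
  then have "2 * (int w2 - int w1) * int (card {c \<in> C. weight c = w1}) =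
      (\<Sum>c\<in>C. 2 * (int w2 - int w1) * (if weight c = w1 then 1 else 0))"
    by (simp only: sum_distrib_left)
  also have "\<dots> = (\<Sum>c\<in>C. coordinate_sum c - (int (card \<Omega>) - 2 * int w2) - (if c = 0 then 2 * int w2 else 0))"
    by (rule sum.cong) (simp_all only: weight_indicator)
  also have "\<dots> = - int (card C) * (int (card \<Omega>) - 2 * int w2) - 2 * int w2"
    by (simp add: sum_subtractf sum_coordinate_sum sum_single[OF zero_mem] algebra_simps)
  finally show ?thesis .
qed

text \<open>
  Both sides are the sum of the squares of the coordinate sums: once by orthogonality, once by
  counting words of each weight.
\<close>

lemma second_moment:
  "int (card C) * (\<Sum>\<omega>\<in>\<Omega>. int (card (repetitions \<omega>))) =
    (int (card \<Omega>) - 2 * int w2)\<^sup>2 * int (card C)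
    + ((int (card \<Omega>) - 2 * int w1)\<^sup>2 - (int (card \<Omega>) - 2 * int w2)\<^sup>2) * int (card {c \<in> C. weight c = w1})
    + (int (card \<Omega>))\<^sup>2 - (int (card \<Omega>) - 2 * int w2)\<^sup>2"
proof -
  let ?n = "int (card \<Omega>)"
  have "int (card C) * (\<Sum>\<omega>\<in>\<Omega>. int (card (repetitions \<omega>))) = (\<Sum>c\<in>C. coordinate_sum c * coordinate_sum c)"
    using correlation_coordinate_sum[OF zero_mem] by (simp add: bit_sign_def)
  also have "\<dots> = (\<Sum>c\<in>C. (?n - 2 * int w2)\<^sup>2
      + ((?n - 2 * int w1)\<^sup>2 - (?n - 2 * int w2)\<^sup>2) * (if weight c = w1 then 1 else 0)
      + (if c = 0 then ?n\<^sup>2 - (?n - 2 * int w2)\<^sup>2 else 0))"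
  proof (rule sum.cong)
    fix c assume "c \<in> C"
    then show "coordinate_sum c * coordinate_sum c = (?n - 2 * int w2)\<^sup>2
      + ((?n - 2 * int w1)\<^sup>2 - (?n - 2 * int w2)\<^sup>2) * (if weight c = w1 then 1 else 0)
      + (if c = 0 then ?n\<^sup>2 - (?n - 2 * int w2)\<^sup>2 else 0)"
      using w1 tw[of c] coordinate_sum_eq[of c] coordinate_sum_0
      by (cases "c = 0") (auto simp: weight_def power2_eq_square)
  qed simp
  also have "\<dots> = (?n - 2 * int w2)\<^sup>2 * int (card C)
      + ((?n - 2 * int w1)\<^sup>2 - (?n - 2 * int w2)\<^sup>2) * (\<Sum>c\<in>C. if weight c = w1 then 1 else 0)
      + (?n\<^sup>2 - (?n - 2 * int w2)\<^sup>2)"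
    unfolding sum.distrib sum_single[OF zero_mem] sum_distrib_left[symmetric] by simp
  also have "(\<Sum>c\<in>C. if weight c = w1 then 1 else 0) = int (card {c \<in> C. weight c = w1})"
    using finite_code by (simp add: sum.If_cases Int_def)
  finally show ?thesis by simp
qed

text \<open>
  The autocorrelation at \<open>d\<close> of the indicator of the light words, computed by the
  affine expression in \<open>weight_indicator\<close>. Orthogonality evaluates the quadratic
  term, the linear terms vanish, and the corrections at the zero word contribute at \<open>c =
  0\<close> and \<open>c = d\<close>.
\<close>

lemma common_light_words:
  assumes projective: "\<And>\<omega>. \<omega> \<in> \<Omega> \<Longrightarrow> card (repetitions \<omega>) = 1"
    and d: "d \<in> C" "d \<noteq> 0"
  shows "(2 * (int w2 - int w1))\<^sup>2 * int (common_words w1 d) =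
    int (card C) * (coordinate_sum d + (int (card \<Omega>) - 2 * int w2)\<^sup>2)
    - 4 * int w2 * (coordinate_sum d - (int (card \<Omega>) - 2 * int w2))"
proof -
  let ?h = "2 * (int w2 - int w1)" and ?\<theta> = "int (card \<Omega>) - 2 * int w2"
  let ?I = "\<lambda>c. if weight c = w1 then 1 else 0 :: int"
  have cd: "c + d = 0 \<longleftrightarrow> c = d" for c
    using bit_add_eq_0 by (auto simp: fun_eq_iff)
  have "int (common_words w1 d) = (\<Sum>c\<in>C. ?I c * ?I (c + d))"
  proof -
    have "(\<Sum>c\<in>C. ?I c * ?I (c + d)) = (\<Sum>c\<in>C. if weight c = w1 \<and> weight (c + d) = w1 then 1 else 0)"
      by (rule sum.cong) auto
    then show ?thesis using finite_code by (simp add: common_words_def sum.If_cases Int_def)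
  qed
  then have "?h\<^sup>2 * int (common_words w1 d) = (\<Sum>c\<in>C. (?h * ?I c) * (?h * ?I (c + d)))"
    by (simp only: sum_distrib_left power2_eq_square mult_ac)
  also have "\<dots> = (\<Sum>c\<in>C. (coordinate_sum c - ?\<theta> - (if c = 0 then 2 * int w2 else 0)) *
      (coordinate_sum (c + d) - ?\<theta> - (if c = d then 2 * int w2 else 0)))"
    by (rule sum.cong) (simp_all only: weight_indicator add_closed d cd)
  also have "\<dots> = (\<Sum>c\<in>C. coordinate_sum c * coordinate_sum (c + d) - ?\<theta> * coordinate_sum c - ?\<theta> * coordinate_sum (c + d) + ?\<theta>\<^sup>2
      - (if c = 0 then 2 * int w2 * (coordinate_sum (c + d) - ?\<theta>) else 0)
      - (if c = d then 2 * int w2 * (coordinate_sum c - ?\<theta>) else 0))"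
    by (rule sum.cong) (use d in \<open>auto simp: algebra_simps power2_eq_square\<close>)
  also have "\<dots> = (\<Sum>c\<in>C. coordinate_sum c * coordinate_sum (c + d)) - ?\<theta> * (\<Sum>c\<in>C. coordinate_sum c) - ?\<theta> * (\<Sum>c\<in>C. coordinate_sum (c + d))
      + int (card C) * ?\<theta>\<^sup>2 - 2 * int w2 * (coordinate_sum d - ?\<theta>) - 2 * int w2 * (coordinate_sum d - ?\<theta>)"
    unfolding sum.distrib sum_subtractf sum_single[OF zero_mem] sum_single[OF d(1)]
      sum_distrib_left[symmetric] add_0_left by simp
  also have "(\<Sum>c\<in>C. coordinate_sum (c + d)) = 0"
    using sum.reindex_bij_betw[OF add_bij[OF d(1)], of coordinate_sum] sum_coordinate_sum by simp
  also have "(\<Sum>c\<in>C. coordinate_sum c * coordinate_sum (c + d)) = int (card C) * coordinate_sum d"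
    unfolding correlation_coordinate_sum[OF d(1)] using projective by (simp add: coordinate_sum_def)
  finally show ?thesis by (simp add: sum_coordinate_sum algebra_simps)
qed

end

text \<open>
  Translation identifies the neighbours of \<open>x\<close> with the words of weight
  \<open>w\<close>, and the common neighbours of \<open>x\<close> and \<open>y\<close> with the
  decompositions of \<open>x + y\<close>.
\<close>

lemma code_graph_strongly_regular:
  assumes w: "w \<noteq> 0" and k: "card {c \<in> C. weight c = w} = k"
    and l: "\<And>d. d \<in> C \<Longrightarrow> weight d = w \<Longrightarrow> common_words w d = l"
    and m: "\<And>d. d \<in> C \<Longrightarrow> d \<noteq> 0 \<Longrightarrow> weight d \<noteq> w \<Longrightarrow> common_words w d = m"
  shows "strongly_regular (code_graph C w) (card C) k l m"
proof -
  have dist: "hamming_distance x y = weight (x + y)" for x y :: "'w \<Rightarrow> bit"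
    unfolding hamming_distance_def weight_def plus_fun_apply bit_add_eq_0 ..
  have cancel: "x + (x + z) = z" for x z :: "'w \<Rightarrow> bit"
    by (metis add.assoc add_0 bit_fun_add_self)
  have deg: "card {y \<in> C. weight (x + y) = w} = k" if x: "x \<in> C" for x
  proof -
    have "bij_betw (\<lambda>c. x + c) {y \<in> C. weight (x + y) = w} {c \<in> C. weight c = w}"
      by (rule bij_betw_byWitness[of _ "\<lambda>c. x + c"]) (use x add_closed in \<open>auto simp: cancel\<close>)
    from bij_betw_same_card[OF this] show ?thesis by (simp only: k)
  qed
  have com: "card {z \<in> C. weight (x + z) = w \<and> weight (y + z) = w} = common_words w (x + y)"
    if x: "x \<in> C" and y: "y \<in> C" for x y
  proof -
    have fwd: "x + z + (x + y) = y + z" for z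
      by (metis add.assoc add.commute cancel)
    have bwd: "y + (x + z) = z + (x + y)" for z
      by (simp only: ac_simps)
    have "bij_betw (\<lambda>c. x + c) {z \<in> C. weight (x + z) = w \<and> weight (y + z) = w}
        {c \<in> C. weight c = w \<and> weight (c + (x + y)) = w}"
    proof (rule bij_betw_byWitness[of _ "\<lambda>c. x + c"])
      show "(+) x ` {z \<in> C. weight (x + z) = w \<and> weight (y + z) = w}
          \<subseteq> {c \<in> C. weight c = w \<and> weight (c + (x + y)) = w}"
        using x add_closed by (auto simp: fwd)
      show "(+) x ` {c \<in> C. weight c = w \<and> weight (c + (x + y)) = w}
          \<subseteq> {z \<in> C. weight (x + z) = w \<and> weight (y + z) = w}"
        using x add_closed by (auto simp: cancel bwd)
    qed (simp_all add: cancel)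
    then show ?thesis unfolding common_words_def by (rule bij_betw_same_card)
  qed
  have ne: "x + y \<noteq> 0" if "x \<noteq> y" for x y :: "'w \<Rightarrow> bit"
    using that bit_add_eq_0 by (auto simp: fun_eq_iff)
  have self: "weight (x + x) \<noteq> w" for x :: "'w \<Rightarrow> bit"
    unfolding bit_fun_add_self using w by (simp add: weight_def)
  show ?thesis
    unfolding code_graph_def strongly_regular_def simple_graph_def split dist
    using self finite_code by (simp add: deg com l m ne add_closed add.commute)
qed

end

text \<open>
  The expression is the discriminant of \<open>t\<^sup>2 - (4096 + m) t + 98304 m - 552\<close>.
  The list holds the integer parts of the square roots.
\<close>

lemma discriminant_between_squares:
  assumes "m \<in> {2..43}"
  shows "\<exists>k \<ge> 0. k\<^sup>2 < m\<^sup>2 - 385024 * m + 16779424 \<and> m\<^sup>2 - 385024 * m + 16779424 < (k + 1 :: int)\<^sup>2"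
proof -
  let ?P = "\<lambda>m k. 0 \<le> k \<and> k\<^sup>2 < m\<^sup>2 - 385024 * m + 16779424 \<and>
    m\<^sup>2 - 385024 * m + 16779424 < (k + 1 :: int)\<^sup>2"
  have "list_all2 ?P [2..43]
    [4001, 3952, 3903, 3854, 3803, 3752, 3701, 3648, 3595, 3541, 3487, 3431, 3374, 3317, 3258, 3199, 3138, 3076, 3013, 2948, 2882, 2815, 2745, 2674, 2601, 2526, 2449, 2369, 2286, 2201, 2111, 2018, 1920, 1817, 1708, 1592, 1466, 1328, 1174, 997, 781, 474]"
    by (simp add: upto_rec1)
  moreover have "m \<in> set [2..43]" unfolding set_upto by (rule assms)
  ultimately show ?thesis unfolding list_all2_conv_all_nth in_set_conv_nth by metis
qed

text \<open>
  The hypotheses are the two moment identities for the weights 47104 and 49152 (doubled: 94208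
  and 98304) and \<open>16777216 = 2^24\<close> words, \<open>a\<close> being the number of
  words of the smaller weight. With \<open>t = 98304 - n\<close> the first equation reads
  \<open>a = 4096 t - 24\<close>, which bounds \<open>t\<close>, and the second one becomes
  \<open>m (98304 - t) = 552 + 4096 t - t\<^sup>2\<close>. The bound on \<open>t\<close> gives
  \<open>m \<le> 44\<close>, and a solution \<open>t\<close> makes the discriminant a square.
  For \<open>m = 1\<close> the roots are \<open>24\<close> and \<open>4073\<close>; parity
  selects the first.
\<close>

lemma length_from_moments:
  fixes n m a :: int
  assumes a: "4096 * a = - 16777216 * (n - 98304) - 98304" "0 \<le> a" "a < 16777216"
    and moment: "16777216 * (n * m) = (n - 98304)\<^sup>2 * 16777216
      + ((n - 94208)\<^sup>2 - (n - 98304)\<^sup>2) * a + n\<^sup>2 - (n - 98304)\<^sup>2"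
    and even: "even n"
  shows "n = 98280" and "m = 1"
proof -
  define t where "t = 98304 - n"
  have n: "n = 98304 - t" by (simp add: t_def)
  have at: "a = 4096 * t - 24" using a(1) by (simp add: n)
  then have t: "1 \<le> t" "t \<le> 4096" using a by auto
  have eq: "m * (98304 - t) = 552 + 4096 * t - t\<^sup>2"
    using moment unfolding n at by (simp add: power2_eq_square algebra_simps)
  have "0 \<le> t * (4096 - t)" using t by simp
  then have "0 < m * (98304 - t)" using eq by (simp add: power2_eq_square algebra_simps)
  then have m1: "1 \<le> m" using t by (simp add: zero_less_mult_iff)
  have "m * 94208 \<le> m * (98304 - t)" using m1 t by (intro mult_left_mono) auto
  \<comment> \<open>The quadratic polynomial in \<open>t\<close> attains its maximum at \<open>t = 2048\<close>.\<close>
  also have "\<dots> \<le> 552 + 2048\<^sup>2" 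
    using eq zero_le_power2[of "t - 2048"] by (simp add: power2_eq_square algebra_simps)
  finally have m44: "m \<le> 44" by simp
  \<comment> \<open>This is the square root of the discriminant.\<close>
  define s where "s = \<bar>2 * t - 4096 - m\<bar>"
  have s: "s\<^sup>2 = m\<^sup>2 - 385024 * m + 16779424"
    using eq by (simp add: s_def power2_eq_square algebra_simps)
  have "m = 1"
  proof (rule ccontr)
    assume "m \<noteq> 1"
    have "m \<noteq> 44"
    proof
      \<comment> \<open>Here the discriminant is negative.\<close>
      assume "m = 44"
      then show False using s zero_le_power2[of s] by simp
    qed
    then have "m \<in> {2..43}" using m1 m44 \<open>m \<noteq> 1\<close> by auto
    then obtain k where k: "0 \<le> k" "k\<^sup>2 < s\<^sup>2" "s\<^sup>2 < (k + 1)\<^sup>2"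
      using discriminant_between_squares unfolding s by blast
    have "k < s" using k(2) by (rule power2_less_imp_less) (simp add: s_def)
    moreover have "s < k + 1" using k(3) by (rule power2_less_imp_less) (use k(1) in simp)
    ultimately show False by simp
  qed
  then have "(t - 24) * (t - 4073) = 0" using eq by (simp add: power2_eq_square algebra_simps)
  moreover have "even t" using even by (simp add: n)
  ultimately have "t = 24" by auto
  then show "n = 98280" by (simp add: n)
  show "m = 1" by fact
qed

section \<open>Parity from commuting involutions\<close>

lemma even_card_moved_points:
  assumes "finite X" and "\<And>x. x \<in> X \<Longrightarrow> f x \<in> X" and "\<And>x. x \<in> X \<Longrightarrow> f (f x) = x"
  shows "even (card {x \<in> X. f x \<noteq> x})"
  using assms
proof (induction "card X" arbitrary: X rule: less_induct)
  case less
  show ?case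
  proof (cases "\<exists>x\<in>X. f x \<noteq> x")
    case True
    then obtain x where x: "x \<in> X" "f x \<noteq> x" by blast
    let ?Y = "X - {x, f x}"
    have "card ?Y < card X" using x less.prems(1) by (intro psubset_card_mono) auto
    moreover have "f y \<in> ?Y" "f (f y) = y" if "y \<in> ?Y" for y
      using that less.prems(2,3) x by (auto, metis+)
    ultimately have "even (card {y \<in> ?Y. f y \<noteq> y})" using less.hyps[of ?Y] less.prems(1) by blast
    moreover have "{z \<in> X. f z \<noteq> z} = {x, f x} \<union> {y \<in> ?Y. f y \<noteq> y}"
      using x less.prems by auto
    then have "card {z \<in> X. f z \<noteq> z} = 2 + card {y \<in> ?Y. f y \<noteq> y}"
      using x less.prems(1) by (simp add: card_Un_disjoint)
    ultimately show ?thesis by simp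
  next
    case False
    then have "{x \<in> X. f x \<noteq> x} = {}" by blast
    then show ?thesis by (simp only: card.empty dvd_0_right)
  qed
qed

text \<open>
  This is the congruence between the size of a set and the number of fixed points of a 2-group
  acting on it, for an elementary abelian group given by generators: each involution in turn
  acts on the common fixed points of the previous ones.
\<close>

lemma even_card_if_no_common_fixed_point:
  assumes "finite X" "finite F"
    and closed: "\<And>f x. f \<in> F \<Longrightarrow> x \<in> X \<Longrightarrow> f x \<in> X"
    and involution: "\<And>f x. f \<in> F \<Longrightarrow> x \<in> X \<Longrightarrow> f (f x) = x"
    and commute: "\<And>f g x. f \<in> F \<Longrightarrow> g \<in> F \<Longrightarrow> x \<in> X \<Longrightarrow> f (g x) = g (f x)"
    and moved: "\<And>x. x \<in> X \<Longrightarrow> \<exists>f\<in>F. f x \<noteq> x"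
  shows "even (card X)"
proof -
  have "even (card X) \<longleftrightarrow> even (card {x \<in> X. \<forall>f\<in>G. f x = x})" if "G \<subseteq> F" for G
    using finite_subset[OF that assms(2)] that
  proof (induction G)
    case (insert f G)
    let ?Y = "{x \<in> X. \<forall>g\<in>G. g x = x}"
    have f: "f \<in> F" and G: "G \<subseteq> F" using insert by auto
    have "even (card {x \<in> ?Y. f x \<noteq> x})"
    proof (rule even_card_moved_points)
      show "f x \<in> ?Y" if x: "x \<in> ?Y" for x
      proof -
        have "g (f x) = f x" if "g \<in> G" for g
          using commute[of g f x] f G that x by force
        then show ?thesis using closed[OF f] x by auto
      qed
    qed (use assms(1) f involution in auto)
    moreover have "card ?Y = card {x \<in> ?Y. f x = x} + card {x \<in> ?Y. f x \<noteq> x}"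
      using assms(1) by (subst card_Un_disjoint[symmetric]) (auto intro!: arg_cong[of _ _ card])
    moreover have "{x \<in> X. \<forall>g\<in>insert f G. g x = x} = {x \<in> ?Y. f x = x}" by auto
    ultimately show ?case using insert by auto
  qed simp
  note this[of F]
  moreover have "{x \<in> X. \<forall>f\<in>F. f x = x} = {}" using moved by blast
  ultimately show ?thesis by simp
qed

section \<open>The Golay code\<close>

text \<open>
  Zero is a square, so it does not belong to this set.
\<close>

definition nonresidues :: "23 set" where
  "nonresidues = {n. \<not> (\<exists>x. n = x\<^sup>2)}"

text \<open>
  Finite computations modulo 23 are carried out on integer representatives.
\<close>

abbreviation rep23 :: "23 \<Rightarrow> int" where "rep23 \<equiv> Rep_bit1"

lemma rep23_range: "rep23 x \<in> {0..<23}"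
  using bit1.Rep_less_n[of x] Rep_bit1[of x] by simp

lemma rep23_bij: "bij_betw rep23 UNIV {0..<23}"
  using type_definition.Rep_range[OF type_definition_bit1] 
  by (auto simp: bij_betw_def inj_def Rep_bit1_inject)

lemma rep23_add: "rep23 (x + y) = (rep23 x + rep23 y) mod 23"
  unfolding bit1.add_def by (subst bit1.Rep_Abs_mod) simp

lemma rep23_mult: "rep23 (x * y) = (rep23 x * rep23 y) mod 23"
  unfolding bit1.mult_def by (subst bit1.Rep_Abs_mod) simp

lemma rep23_uminus: "rep23 (- x) = (- rep23 x) mod 23"
  unfolding bit1.minus_def by (subst bit1.Rep_Abs_mod) simp

lemma ball_interval_23: "(\<forall>r\<in>{0..<23::int}. P r) \<longleftrightarrow> (\<forall>r\<in>set [0..22]. P r)"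
  unfolding set_upto by auto

definition nonresidue_reps :: "int set" where
  "nonresidue_reps = {5,7,10,11,14,15,17,19,20,21,22}"

lemma mem_nonresidues: "x \<in> nonresidues \<longleftrightarrow> rep23 x \<in> nonresidue_reps"
proof -
  have "\<forall>r\<in>{0..<23}. r \<in> nonresidue_reps \<longleftrightarrow> (\<forall>k\<in>{0..<23}. r \<noteq> (k * k) mod 23)"
    unfolding ball_interval_23 nonresidue_reps_def by code_simp
  then have "rep23 x \<in> nonresidue_reps \<longleftrightarrow> (\<forall>k\<in>rep23 ` UNIV. rep23 x \<noteq> (k * k) mod 23)"
    using rep23_range[of x] rep23_bij unfolding bij_betw_def by simp
  also have "\<dots> \<longleftrightarrow> (\<forall>y. rep23 x \<noteq> rep23 (y\<^sup>2))"
    by (simp add: power2_eq_square rep23_mult)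
  finally show ?thesis by (simp add: nonresidues_def Rep_bit1_inject)
qed

text \<open>
  This is the fact that \<open>-1\<close> is not a square modulo 23.
\<close>

lemma nonresidue_or_neg:
  assumes "x \<noteq> 0"
  shows "x \<in> nonresidues \<longleftrightarrow> - x \<notin> nonresidues"
proof -
  have "\<forall>r\<in>{0..<23}. r \<noteq> 0 \<longrightarrow> (r \<in> nonresidue_reps \<longleftrightarrow> (- r) mod 23 \<notin> nonresidue_reps)"
    unfolding ball_interval_23 nonresidue_reps_def by code_simp
  moreover have "rep23 x \<noteq> 0" using assms by (metis Rep_bit1_inject bit1.Rep_0)
  ultimately show ?thesis
    unfolding mem_nonresidues rep23_uminus using rep23_range[of x] by blast
qed

lemma card_nonresidues_translate:
  "card {y \<in> nonresidues. y + d \<in> nonresidues} =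
    card (Set.filter (\<lambda>k. (k + rep23 d) mod 23 \<in> nonresidue_reps) nonresidue_reps)"
proof -
  have "card {y \<in> nonresidues. y + d \<in> nonresidues} = card (rep23 ` {y \<in> nonresidues. y + d \<in> nonresidues})"
    by (rule card_image[symmetric]) (simp add: inj_on_def Rep_bit1_inject)
  also have "rep23 ` {y \<in> nonresidues. y + d \<in> nonresidues} =
      Set.filter (\<lambda>k. (k + rep23 d) mod 23 \<in> nonresidue_reps) nonresidue_reps"
  proof -
    have "\<exists>y. k = rep23 y" if "k \<in> nonresidue_reps" for k
    proof -
      have "k \<in> rep23 ` UNIV"
        using that rep23_bij by (auto simp: bij_betw_def nonresidue_reps_def)
      then show ?thesis by auto
    qed
    then show ?thesis by (auto simp: mem_nonresidues rep23_add)
  qed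
  finally show ?thesis .
qed

text \<open>
  The size is 5, or 11 for the trivial translation. Together with the point at infinity it makes
  the intersection of any two generators of the Golay code even.
\<close>

lemma odd_card_nonresidues_translate: "odd (card {y \<in> nonresidues. y + d \<in> nonresidues})"
proof -
  have "\<forall>e\<in>{0..<23}.
      odd (card (Set.filter (\<lambda>k. (k + e) mod 23 \<in> nonresidue_reps) nonresidue_reps))"
    unfolding ball_interval_23 nonresidue_reps_def by code_simp
  then show ?thesis unfolding card_nonresidues_translate using rep23_range[of d] by blast
qed

lemma card_nonresidues: "card nonresidues = 11"
proof -
  have "card (Set.filter (\<lambda>k. (k + 0) mod 23 \<in> nonresidue_reps) nonresidue_reps) = 11"
    unfolding nonresidue_reps_def by code_simp
  then show ?thesis using card_nonresidues_translate[of 0] by (simp add: bit1.Rep_0)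
qed

lemma mem_golay_generator_Some:
  "None \<in> golay_generator (Some a)" "Some b \<in> golay_generator (Some a) \<longleftrightarrow> b + a \<in> nonresidues"
proof -
  have "Some b \<in> golay_generator (Some a) \<longleftrightarrow> (\<exists>n. b = n - a \<and> n \<in> nonresidues)"
    by (simp add: nonresidues_def)
  also have "\<dots> \<longleftrightarrow> b + a \<in> nonresidues"
    by (metis add_diff_cancel_right' diff_add_cancel)
  finally show "Some b \<in> golay_generator (Some a) \<longleftrightarrow> b + a \<in> nonresidues" .
qed simp

lemma golay_generator_Some:
  "golay_generator (Some a) = insert None (Some ` (\<lambda>x. x - a) ` nonresidues)"
  by (auto simp: nonresidues_def image_iff)

text \<open>
  Infinity lies in every generator, whereas the finite point \<open>b\<close> is missing from
  the one labelled \<open>-b\<close>. For finite points \<open>a\<close> and \<open>b\<close>,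
  exactly one of \<open>a - b\<close> and \<open>b - a\<close> is a nonresidue, and this decides
  between the generators labelled \<open>-b\<close> and \<open>-a\<close>.
\<close>

lemma golay_generators_separate:
  assumes "i \<noteq> j"
  shows "\<exists>g. i \<in> golay_generator g \<longleftrightarrow> j \<notin> golay_generator g"
proof -
  have zero: "0 \<notin> nonresidues"
    unfolding nonresidues_def by (auto intro!: exI[of _ 0])
  have None: "None \<in> golay_generator (Some (- b)) \<and> Some b \<notin> golay_generator (Some (- b))" for b
    unfolding mem_golay_generator_Some(2) using zero by simp
  show ?thesis
  proof (cases i; cases j)
    fix a b assume ij: "i = Some a" "j = Some b"
    then have "a - b \<noteq> 0" using assms by simp
    then have "a - b \<in> nonresidues \<longleftrightarrow> b - a \<notin> nonresidues"
      using nonresidue_or_neg[of "a - b"] by simp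
    then have "i \<in> golay_generator (Some (- b)) \<and> j \<notin> golay_generator (Some (- b)) \<or>
        i \<notin> golay_generator (Some (- a)) \<and> j \<in> golay_generator (Some (- a))"
      unfolding ij mem_golay_generator_Some(2) using zero by auto
    then show ?thesis by blast
  qed (use assms None in blast)+
qed

lemma card_golay_generator: "4 dvd card (golay_generator g)"
proof (cases g)
  case None
  then show ?thesis by (simp add: card_UNIV_option)
next
  case (Some a)
  have "card (Some ` (\<lambda>x. x - a) ` nonresidues) = 11"
    by (subst card_image, simp add: inj_on_def, subst card_image)
      (auto simp: inj_on_def card_nonresidues)
  then show ?thesis unfolding Some golay_generator_Some by (subst card_insert_disjoint) auto
qed

lemma even_card_golay_generators_Int: "even (card (golay_generator g \<inter> golay_generator h))"
proof -
  have even_gen: "even (card (golay_generator g))" for g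
    using card_golay_generator[of g] by (meson dvd_trans even_numeral)
  show ?thesis
  proof (cases g; cases h)
    fix a b assume gh: "g = Some a" "h = Some b"
    have "golay_generator g \<inter> golay_generator h =
        insert None ((\<lambda>y. Some (y - a)) ` {y \<in> nonresidues. y + (b - a) \<in> nonresidues})"
    proof (rule Set.set_eqI)
      fix i
      show "i \<in> golay_generator g \<inter> golay_generator h \<longleftrightarrow>
          i \<in> insert None ((\<lambda>y. Some (y - a)) ` {y \<in> nonresidues. y + (b - a) \<in> nonresidues})"
      proof (cases i)
        case (Some x)
        have "Some x \<in> (\<lambda>y. Some (y - a)) ` {y \<in> nonresidues. y + (b - a) \<in> nonresidues}
            \<longleftrightarrow> x + a \<in> nonresidues \<and> x + b \<in> nonresidues"
          by (auto simp: image_iff algebra_simps intro!: bexI[of _ "x + a"])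
        then show ?thesis unfolding Some gh by (simp add: mem_golay_generator_Some del: golay_generator.simps)
      qed (simp add: gh)
    qed
    moreover have "card ((\<lambda>y. Some (y - a)) ` {y \<in> nonresidues. y + (b - a) \<in> nonresidues}) =
        card {y \<in> nonresidues. y + (b - a) \<in> nonresidues}"
      by (rule card_image) (simp add: inj_on_def)
    ultimately show ?thesis
      using odd_card_nonresidues_translate[of "b - a"] by (simp add: card_insert_if image_iff)
  qed (use even_gen[of g] even_gen[of h] in auto)
qed

lemma golay_code_sym_diff:
  assumes "S \<in> golay_code" "T \<in> golay_code"
  shows "(S - T) \<union> (T - S) \<in> golay_code"
proof -
  obtain J K where S: "S = {i. odd (card {j \<in> J. i \<in> golay_generator j})}"
    and T: "T = {i. odd (card {j \<in> K. i \<in> golay_generator j})}"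
    using assms by (auto simp: golay_code_def)
  have "odd (card {j \<in> (J - K) \<union> (K - J). i \<in> golay_generator j}) \<longleftrightarrow> (i \<in> S) \<noteq> (i \<in> T)" for i
  proof -
    let ?J = "{j \<in> J. i \<in> golay_generator j}" and ?K = "{j \<in> K. i \<in> golay_generator j}"
    have "card ?J = card (?J - ?K) + card (?J \<inter> ?K)" "card ?K = card (?K - ?J) + card (?J \<inter> ?K)"
      by (subst card_Un_disjoint[symmetric]; auto intro!: arg_cong[of _ _ card])+
    moreover have "{j \<in> (J - K) \<union> (K - J). i \<in> golay_generator j} = (?J - ?K) \<union> (?K - ?J)" by auto
    then have "card {j \<in> (J - K) \<union> (K - J). i \<in> golay_generator j} = card (?J - ?K) + card (?K - ?J)"
      by (simp only:) (rule card_Un_disjoint, auto)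
    ultimately show ?thesis unfolding S T by auto
  qed
  then have "(S - T) \<union> (T - S) = {i. odd (card {j \<in> (J - K) \<union> (K - J). i \<in> golay_generator j})}"
    by auto
  then show ?thesis unfolding golay_code_def by blast
qed

lemma golay_generator_mem: "golay_generator g \<in> golay_code"
proof -
  have "{j \<in> {g}. i \<in> golay_generator j} = (if i \<in> golay_generator g then {g} else {})" for i by auto
  then have "golay_generator g = {i. odd (card {j \<in> {g}. i \<in> golay_generator j})}" by auto
  then show ?thesis unfolding golay_code_def by blast
qed

lemma empty_UNIV_mem_golay_code: "{} \<in> golay_code" "UNIV \<in> golay_code"
proof -
  have "{} = {i. odd (card {j \<in> {}. i \<in> golay_generator j})}" by simp
  then show "{} \<in> golay_code" unfolding golay_code_def by blast
  show "UNIV \<in> golay_code" using golay_generator_mem[of None] by simp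
qed

lemma golay_code_induct [consumes 1, case_names empty sym_diff]:
  assumes "S \<in> golay_code" and "P {}"
    and step: "\<And>S g. P S \<Longrightarrow> P ((S - golay_generator g) \<union> (golay_generator g - S))"
  shows "P S"
proof -
  have "P {i. odd (card {j \<in> J. i \<in> golay_generator j})}" for J :: "PL23 set"
    using finite[of J]
  proof (induction J)
    case empty
    then show ?case using assms(2) by simp
  next
    case (insert g J)
    have "card {j \<in> insert g J. i \<in> golay_generator j} =
        (if i \<in> golay_generator g then Suc (card {j \<in> J. i \<in> golay_generator j})
         else card {j \<in> J. i \<in> golay_generator j})" for i
    proof -
      have "{j \<in> insert g J. i \<in> golay_generator j} =
        (if i \<in> golay_generator g then insert g {j \<in> J. i \<in> golay_generator j}
         else {j \<in> J. i \<in> golay_generator j})" by auto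
      then show ?thesis using insert.hyps by simp
    qed
    then have "{i. odd (card {j \<in> insert g J. i \<in> golay_generator j})} =
      ({i. odd (card {j \<in> J. i \<in> golay_generator j})} - golay_generator g) \<union>
      (golay_generator g - {i. odd (card {j \<in> J. i \<in> golay_generator j})})"
      by auto
    then show ?case using step[OF insert.IH] by simp
  qed
  then show ?thesis using assms(1) unfolding golay_code_def by auto
qed

lemma card_sym_diff:
  fixes S T :: "'a::finite set"
  shows "card ((S - T) \<union> (T - S)) + 2 * card (S \<inter> T) = card S + card T"
proof -
  have "card S = card (S - T) + card (S \<inter> T)" "card T = card (T - S) + card (S \<inter> T)"
    by (subst card_Un_disjoint[symmetric]; auto intro!: arg_cong[of _ _ card])+
  moreover have "card ((S - T) \<union> (T - S)) = card (S - T) + card (T - S)"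
    by (rule card_Un_disjoint) auto
  ultimately show ?thesis by simp
qed

lemma even_card_sym_diff_Int:
  fixes S T U :: "'a::finite set"
  assumes "even (card (S \<inter> U))" "even (card (T \<inter> U))"
  shows "even (card (((S - T) \<union> (T - S)) \<inter> U))"
proof -
  have "((S - T) \<union> (T - S)) \<inter> U = ((S \<inter> U) - (T \<inter> U)) \<union> ((T \<inter> U) - (S \<inter> U))" by auto
  then show ?thesis using card_sym_diff[of "S \<inter> U" "T \<inter> U"] assms
    by (metis dvd_add_left_iff dvd_add_right_iff dvd_triv_left)
qed

lemma golay_code_self_orthogonal:
  assumes "S \<in> golay_code" "T \<in> golay_code"
  shows "even (card (S \<inter> T))"
proof -
  have gen: "even (card (S \<inter> golay_generator h))" for h
    using assms(1)
    by (induction rule: golay_code_induct)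
      (simp, intro even_card_sym_diff_Int even_card_golay_generators_Int)
  have "even (card (T \<inter> S))" using assms(2)
  proof (induction rule: golay_code_induct)
    case (sym_diff T g)
    then show ?case using gen[of g] by (intro even_card_sym_diff_Int) (simp_all add: Int_commute)
  qed simp
  then show ?thesis by (simp add: Int_commute)
qed

text \<open>
  The sizes of the generators are 12 and 24, and \<open>|S + T| = |S| + |T| - 2 |S \<inter>
  T|\<close> with an even intersection.
\<close>

lemma golay_code_doubly_even:
  assumes "S \<in> golay_code"
  shows "4 dvd card S"
proof -
  have "S \<in> golay_code \<and> 4 dvd card S" using assms
  proof (induction rule: golay_code_induct)
    case empty
    then show ?case by (simp add: empty_UNIV_mem_golay_code)
  next
    case (sym_diff S g)
    let ?T = "(S - golay_generator g) \<union> (golay_generator g - S)"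
    have "4 dvd 2 * card (S \<inter> golay_generator g)"
      using golay_code_self_orthogonal[OF _ golay_generator_mem, of S g] sym_diff by (auto elim!: evenE)
    then have "4 dvd card ?T"
      using card_sym_diff[of S "golay_generator g"] card_golay_generator[of g] sym_diff
      by (metis dvd_add dvd_add_left_iff)
    then show ?case using golay_code_sym_diff[OF _ golay_generator_mem] sym_diff by blast
  qed
  then show ?thesis ..
qed

section \<open>Sign changes of the Leech lattice\<close>

definition sign_change :: "PL23 set \<Rightarrow> R24 \<Rightarrow> R24" where
  "sign_change S x = (\<chi> i. if i \<in> S then - x $ i else x $ i)"

lemma sign_change_nth [simp]: "sign_change S x $ i = (if i \<in> S then - x $ i else x $ i)"
  by (simp add: sign_change_def)

text \<open>
  Let \<open>T\<close> be the set of positions where \<open>z i\<close> is congruent to \<open>m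
  + 2\<close> modulo 4. The sum of \<open>z\<close> over \<open>S\<close> is congruent to
  \<open>2 |S \<inter> T| + m |S|\<close> modulo 4, hence divisible by 4, as the Golay code is
  self-orthogonal and doubly even; so the total changes by a multiple of 8. For odd
  \<open>m\<close> the sets of positions with a prescribed residue modulo 4 change by the
  symmetric difference with \<open>S\<close>; for even \<open>m\<close> they stay the same.
\<close>

lemma sign_change_leech:
  assumes S: "S \<in> golay_code" and x: "x \<in> leech_lattice"
  shows "sign_change S x \<in> leech_lattice"
proof -
  obtain z m where xz: "x = (\<chi> i. of_int (z i) / sqrt 8)"
    and par: "\<And>i. z i mod 2 = m mod 2" and sum8: "(\<Sum>i\<in>UNIV. z i) mod 8 = (4 * m) mod 8"
    and gol: "\<And>k. {i. z i mod 4 = k mod 4} \<in> golay_code"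
    using x unfolding leech_lattice_def by blast
  define z' where "z' i = (if i \<in> S then - z i else z i)" for i
  have "sign_change S x = (\<chi> i. of_int (z' i) / sqrt 8)"
    by (simp add: Finite_Cartesian_Product.vec_eq_iff xz z'_def)
  moreover have z'2: "z' i mod 2 = m mod 2" for i
    unfolding par[of i, symmetric] by (simp add: z'_def mod2_eq_if)
  moreover have "(\<Sum>i\<in>UNIV. z' i) mod 8 = (4 * m) mod 8"
  proof -
    define T where "T = {i. z i mod 4 = (m + 2) mod 4}"
    have z4: "4 dvd z i - ((if i \<in> T then 2 else 0) + m)" for i
    proof -
      have "4 dvd y - (if y mod 4 = (m + 2) mod 4 then 2 + m else m)" if y2: "y mod 2 = m mod 2" for y
      proof (cases "y mod 4 = (m + 2) mod 4")
        case True
        then show ?thesis by (simp add: mod_eq_dvd_iff algebra_simps)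
      next
        case False
        obtain q where q: "y = m + 2 * q" using y2[symmetric] by (rule mod_eqE)
        have "even q"
        proof (rule ccontr)
          assume "odd q"
          then obtain r where "q = 2 * r + 1" by (rule oddE)
          then have "y = (m + 2) + 4 * r" using q by simp
          then show False using False by simp
        qed
        then show ?thesis using False q by auto
      qed
      from this[OF par[of i]] show ?thesis by (simp add: T_def split: if_splits)
    qed
    have "(\<Sum>i\<in>S. (if i \<in> T then 2 else 0) + m) = 2 * int (card (S \<inter> T)) + m * int (card S)"
      by (simp add: sum.distrib sum.If_cases Int_def)
    moreover have "4 dvd 2 * int (card (S \<inter> T))"
      using golay_code_self_orthogonal[OF S gol, of "m + 2"] unfolding T_def by (auto elim!: evenE)
    moreover have "4 dvd m * int (card S)"
      using golay_code_doubly_even[OF S] by (auto elim!: dvdE)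
    moreover have "4 dvd (\<Sum>i\<in>S. z i - ((if i \<in> T then 2 else 0) + m))"
      by (intro dvd_sum z4)
    moreover have "(\<Sum>i\<in>S. z i) = (\<Sum>i\<in>S. z i - ((if i \<in> T then 2 else 0) + m)) +
        (\<Sum>i\<in>S. (if i \<in> T then 2 else 0) + m)"
      by (simp add: sum_subtractf)
    ultimately have "4 dvd (\<Sum>i\<in>S. z i)"
      by (simp only: dvd_add)
    then have "8 dvd 2 * (\<Sum>i\<in>S. z i)" by (auto elim!: dvdE)
    moreover have "(\<Sum>i\<in>UNIV. z' i) = (\<Sum>i\<in>UNIV. z i) - 2 * (\<Sum>i\<in>S. z i)"
    proof -
      have "(\<Sum>i\<in>UNIV. z' i) = (\<Sum>i\<in>UNIV. z i - 2 * (if i \<in> S then z i else 0))"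
        by (rule sum.cong) (auto simp: z'_def)
      then show ?thesis by (simp add: sum_subtractf sum_distrib_left[symmetric] sum.If_cases)
    qed
    ultimately have "(\<Sum>i\<in>UNIV. z' i) mod 8 = (\<Sum>i\<in>UNIV. z i) mod 8"
      unfolding mod_eq_dvd_iff by simp
    then show ?thesis using sum8 by simp
  qed
  moreover have "{i. z' i mod 4 = k mod 4} \<in> golay_code" for k
  proof -
    have "k mod 2 \<noteq> m mod 2 \<or> even m \<and> even k \<or> odd m \<and> odd k"
      by (auto simp: mod2_eq_if)
    then consider "k mod 2 \<noteq> m mod 2" | "even m" "even k" | "odd m" "odd k" by blast
    then show ?thesis
    proof cases
      case 1
      have "z' i mod 4 \<noteq> k mod 4" for i
      proof
        assume "z' i mod 4 = k mod 4"
        then have "z' i mod 2 = k mod 2"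
          using mod_mod_cancel[of 2 4 "z' i"] mod_mod_cancel[of 2 4 k] by simp
        then show False using 1 z'2[of i] by metis
      qed
      then have "{i. z' i mod 4 = k mod 4} = {}" by blast
      then show ?thesis by (simp only: empty_UNIV_mem_golay_code)
    next
      case 2
      have "z' i mod 4 = z i mod 4" for i
      proof -
        have "even (z i)" using par[of i] 2(1) by (simp add: even_iff_mod_2_eq_zero)
        moreover have "(- y) mod 4 = y mod 4" if "even y" for y :: int
          unfolding mod_eq_dvd_iff using that by (auto elim!: evenE)
        ultimately show ?thesis by (simp add: z'_def)
      qed
      then show ?thesis using gol[of k] by simp
    next
      case 3
      have "z' i mod 4 = k mod 4 \<longleftrightarrow> (if i \<in> S then z i mod 4 \<noteq> k mod 4 else z i mod 4 = k mod 4)" for i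
      proof -
        have "odd (z i)" using par[of i] 3(1) by (simp add: even_iff_mod_2_eq_zero)
        moreover have "(- y) mod 4 = k mod 4 \<longleftrightarrow> y mod 4 \<noteq> k mod 4" if y: "odd y" for y
        proof -
          obtain a b where ab: "y = 2 * a + 1" "k = 2 * b + 1" using y 3(2) by (auto elim!: oddE)
          have four: "4 dvd 2 * x \<longleftrightarrow> even x" for x :: int
            using dvd_times_left_cancel_iff[of 2 2 x] by simp
          have "- y - k = 2 * (- (a + b + 1))" "y - k = 2 * (a - b)"
            by (simp_all add: ab)
          then have "(- y) mod 4 = k mod 4 \<longleftrightarrow> odd (a + b)" "y mod 4 = k mod 4 \<longleftrightarrow> even (a - b)"
            unfolding mod_eq_dvd_iff by (simp_all only: four) (cases "even a"; simp)
          then show ?thesis by simp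
        qed
        ultimately show ?thesis by (simp add: z'_def)
      qed
      then have "{i. z' i mod 4 = k mod 4} =
          ({i. z i mod 4 = k mod 4} - S) \<union> (S - {i. z i mod 4 = k mod 4})"
        by auto
      then show ?thesis using golay_code_sym_diff[OF gol S] by simp
    qed
  qed
  ultimately show ?thesis unfolding leech_lattice_def by blast
qed

lemma norm_scaled_integer_vector:
  fixes z :: "PL23 \<Rightarrow> int"
  shows "(norm ((\<chi> i. of_int (z i) / sqrt 8) :: R24))\<^sup>2 = of_int (\<Sum>i\<in>UNIV. (z i)\<^sup>2) / 8"
  unfolding power2_norm_eq_inner inner_vec_def
  by (simp add: sum_divide_distrib power2_eq_square)

text \<open>
  If only one entry \<open>z i\<close> is nonzero, then \<open>m\<close> is even and \<open>z
  i\<close>, being the sum of all entries, is a multiple of 8. The squared norm is then at least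
  8, whereas \<open>(4, 4, 0, \<dots>, 0) / \<surd>8\<close> has squared norm 4.
\<close>

lemma minimal_vector_two_coordinates:
  fixes v :: R24
  assumes "v \<in> minimal_vectors leech_lattice"
  shows "\<exists>i j. i \<noteq> j \<and> v $ i \<noteq> 0 \<and> v $ j \<noteq> 0"
proof (rule ccontr)
  assume single: "\<not> ?thesis"
  have v: "v \<in> leech_lattice" "v \<noteq> 0" and min: "\<And>u. u \<in> leech_lattice \<Longrightarrow> u \<noteq> 0 \<Longrightarrow> norm v \<le> norm u"
    using assms by (auto simp: minimal_vectors_def)
  obtain z m where vz: "v = (\<chi> i. of_int (z i) / sqrt 8)"
    and par: "\<And>i. z i mod 2 = m mod 2" and sum8: "(\<Sum>i\<in>UNIV. z i) mod 8 = (4 * m) mod 8"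
    using v(1) unfolding leech_lattice_def by blast
  obtain i where i: "v $ i \<noteq> 0" using v(2) by (auto simp: Finite_Cartesian_Product.vec_eq_iff)
  have zero: "z j = 0" if "j \<noteq> i" for j
    using single i that by (auto simp: vz)
  obtain j :: PL23 where "j \<noteq> i" by (metis option.distinct(1))
  then have "even m" using par[of j] zero[of j] by (simp add: even_iff_mod_2_eq_zero)
  moreover have "(\<Sum>i\<in>UNIV. z i) = z i"
    using zero by (subst sum.remove[of _ i]) auto
  ultimately have "8 dvd z i" using sum8 by (auto elim!: evenE)
  moreover have "z i \<noteq> 0" using i by (auto simp: vz)
  ultimately have "8 \<le> \<bar>z i\<bar>" by (metis abs_of_nonneg dvd_imp_le_int zero_le_numeral)
  then have z64: "8\<^sup>2 \<le> (z i)\<^sup>2" by (metis abs_le_square_iff abs_numeral)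
  \<comment> \<open>The vector \<open>(4, 4, 0, \<dots>, 0)\<close>.\<close>
  define y :: "PL23 \<Rightarrow> int" where "y = (\<lambda>i. if i = None \<or> i = Some 0 then 4 else 0)"
  define u :: R24 where "u = (\<chi> i. of_int (y i) / sqrt 8)"
  have y_sum: "(\<Sum>i\<in>UNIV. h (y i)) = 2 * h 4" if "h 0 = 0" for h :: "int \<Rightarrow> int"
  proof -
    have "(\<Sum>i\<in>UNIV. h (y i)) = (\<Sum>i\<in>{None, Some 0}. h (y i))"
      by (rule sum.mono_neutral_right) (auto simp: y_def that)
    then show ?thesis by (simp add: y_def)
  qed
  have "u \<in> leech_lattice"
    unfolding leech_lattice_def
  proof (rule CollectI, rule exI[of _ y], rule conjI[OF u_def], rule exI[of _ 0], intro conjI allI)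
    show "(\<Sum>i\<in>UNIV. y i) mod 8 = (4 * 0) mod 8" using y_sum[of "\<lambda>x. x"] by simp
    fix k
    have "{i. y i mod 4 = k mod 4} = (if k mod 4 = 0 then UNIV else {})"
      by (auto simp: y_def)
    then show "{i. y i mod 4 = k mod 4} \<in> golay_code"
      using empty_UNIV_mem_golay_code by simp
  qed (simp add: y_def)
  moreover have "u \<noteq> 0"
  proof
    assume "u = 0"
    then have "u $ None = 0" by simp
    then show False by (simp add: u_def y_def)
  qed
  ultimately have "norm v \<le> norm u" by (rule min)
  then have "(norm v)\<^sup>2 \<le> (norm u)\<^sup>2" by simp
  moreover have "(norm u)\<^sup>2 = 4"
    unfolding u_def norm_scaled_integer_vector using y_sum[of "\<lambda>x. x\<^sup>2"] by simp
  moreover have "(norm v)\<^sup>2 = of_int ((z i)\<^sup>2) / 8"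
  proof -
    have "(\<Sum>i\<in>UNIV. (z i)\<^sup>2) = (z i)\<^sup>2"
      using zero by (subst sum.remove[of _ i]) auto
    then show ?thesis unfolding vz norm_scaled_integer_vector by simp
  qed
  ultimately have "real_of_int ((z i)\<^sup>2) \<le> 32" by simp
  then have "(z i)\<^sup>2 \<le> 32" by linarith
  then show False using z64 by simp
qed

text \<open>
  A generator that contains exactly one of two positions in the support reverses one of these
  entries and keeps the other.
\<close>

lemma sign_change_moves_minimal_vector:
  assumes "v \<in> minimal_vectors leech_lattice"
  shows "\<exists>g. sign_change (golay_generator g) v \<noteq> v \<and> sign_change (golay_generator g) v \<noteq> - v"
proof -
  obtain i j where ij: "i \<noteq> j" "v $ i \<noteq> 0" "v $ j \<noteq> 0"
    using minimal_vector_two_coordinates[OF assms] by blast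
  obtain g where "i \<in> golay_generator g \<longleftrightarrow> j \<notin> golay_generator g"
    using golay_generators_separate[OF ij(1)] by blast
  then show ?thesis
    using ij by (intro exI[of _ g]) (auto simp: Finite_Cartesian_Product.vec_eq_iff intro: exI[of _ i] exI[of _ j])
qed

section \<open>The action of the Conway group on cosets\<close>

lemma carrier_Aut_Leech:
  "f \<in> carrier Aut_Leech \<longleftrightarrow> orthogonal_transformation f \<and> f ` leech_lattice = leech_lattice"
  by (simp add: Aut_Leech_def)

lemma mult_Aut_Leech [simp]: "f \<otimes>\<^bsub>Aut_Leech\<^esub> g = f \<circ> g"
  by (simp add: Aut_Leech_def)

lemma one_Aut_Leech [simp]: "\<one>\<^bsub>Aut_Leech\<^esub> = id"
  by (simp add: Aut_Leech_def)

lemma group_Aut_Leech: "group Aut_Leech"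
proof (rule groupI)
  fix f assume f: "f \<in> carrier Aut_Leech"
  then have b: "bij f" and o: "orthogonal_transformation f" and L: "f ` leech_lattice = leech_lattice"
    by (auto simp: carrier_Aut_Leech intro: orthogonal_transformation_bij)
  have "inv_into UNIV f ` leech_lattice = leech_lattice"
    by (metis L b bij_is_inj image_inv_f_f)
  then have "inv_into UNIV f \<in> carrier Aut_Leech"
    using o by (simp add: carrier_Aut_Leech orthogonal_transformation_inv)
  moreover have "inv_into UNIV f \<circ> f = id" using b by (simp add: bij_is_inj)
  ultimately show "\<exists>g\<in>carrier Aut_Leech. g \<otimes>\<^bsub>Aut_Leech\<^esub> f = \<one>\<^bsub>Aut_Leech\<^esub>" by auto
next
  show "f \<otimes>\<^bsub>Aut_Leech\<^esub> g \<in> carrier Aut_Leech"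
    if "f \<in> carrier Aut_Leech" "g \<in> carrier Aut_Leech" for f g
    using that unfolding carrier_Aut_Leech mult_Aut_Leech image_comp[symmetric]
    by (simp add: orthogonal_transformation_compose)
qed (simp_all add: carrier_Aut_Leech o_assoc orthogonal_transformation_def[of id] linear_id)

lemma sign_change_sign_change: "sign_change S (sign_change T x) = sign_change T (sign_change S x)"
    and sign_change_involution: "sign_change S (sign_change S x) = x"
  by (simp_all add: Finite_Cartesian_Product.vec_eq_iff)

lemma sign_change_mem_Aut_Leech:
  assumes "S \<in> golay_code"
  shows "sign_change S \<in> carrier Aut_Leech"
proof -
  have "linear (sign_change S)"
    by (rule linearI) (auto simp: Finite_Cartesian_Product.vec_eq_iff)
  moreover have "sign_change S x \<bullet> sign_change S y = x \<bullet> y" for x y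
    unfolding inner_vec_def by (rule sum.cong) auto
  moreover have "sign_change S ` leech_lattice = leech_lattice"
  proof (intro subset_antisym subsetI)
    fix x assume "x \<in> leech_lattice"
    then show "x \<in> sign_change S ` leech_lattice"
      using sign_change_leech[OF assms]
      by (intro image_eqI[of _ _ "sign_change S x"]) (simp_all add: sign_change_involution)
  qed (use sign_change_leech[OF assms] in auto)
  ultimately show ?thesis by (simp add: carrier_Aut_Leech orthogonal_transformation_def)
qed

lemma minimal_vector_image:
  assumes f: "f \<in> carrier Aut_Leech" and v: "v \<in> minimal_vectors leech_lattice"
  shows "f v \<in> minimal_vectors leech_lattice"
proof -
  have norm: "norm (f v) = norm v"
    using f orthogonal_transformation_norm[of f v] unfolding carrier_Aut_Leech by blast
  have "v \<noteq> 0" "v \<in> leech_lattice" using v by (auto simp: minimal_vectors_def)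
  then have "norm (f v) \<noteq> 0" unfolding norm by simp
  then have "f v \<noteq> 0" by (intro notI) simp
  moreover have "f v \<in> leech_lattice" using f \<open>v \<in> leech_lattice\<close> unfolding carrier_Aut_Leech by blast
  ultimately show ?thesis using v norm by (simp add: minimal_vectors_def)
qed

lemma uminus_mem_Aut_Leech: "uminus \<in> carrier Aut_Leech"
proof -
  have "sign_change UNIV = uminus" by (auto simp: fun_eq_iff Finite_Cartesian_Product.vec_eq_iff)
  then show ?thesis using sign_change_mem_Aut_Leech[OF empty_UNIV_mem_golay_code(2)] by simp
qed

lemma minus_one_subset: "minus_one \<subseteq> {id, uminus}"
proof -
  interpret group Aut_Leech by (rule group_Aut_Leech)
  have uu: "uminus \<circ> uminus = (id :: R24 \<Rightarrow> R24)" by (simp add: fun_eq_iff)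
  have "subgroup {id, uminus} Aut_Leech"
  proof (rule subgroupI)
    show "{id, uminus} \<subseteq> carrier Aut_Leech"
      using uminus_mem_Aut_Leech one_closed by simp
    show "inv\<^bsub>Aut_Leech\<^esub> f \<in> {id, uminus}" if "f \<in> {id, uminus}" for f
      using that inv_equality[of uminus uminus] uminus_mem_Aut_Leech uu inv_one by auto
  qed (use uu in auto)
  then show ?thesis unfolding minus_one_def by (intro generate_subgroup_incl) auto
qed

text \<open>
  The subgroup is central: automorphisms of the lattice are linear and commute with negation.
\<close>

lemma minus_one_normal: "minus_one \<lhd> Aut_Leech"
proof -
  interpret group Aut_Leech by (rule group_Aut_Leech)
  have "subgroup minus_one Aut_Leech"
    unfolding minus_one_def using uminus_mem_Aut_Leech by (intro generate_is_subgroup) auto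
  moreover have "f \<otimes>\<^bsub>Aut_Leech\<^esub> h \<otimes>\<^bsub>Aut_Leech\<^esub> inv\<^bsub>Aut_Leech\<^esub> f \<in> minus_one"
    if f: "f \<in> carrier Aut_Leech" and h: "h \<in> minus_one" for f h
  proof -
    have "linear f" using f by (simp add: carrier_Aut_Leech orthogonal_transformation_linear)
    then have "f \<circ> h = h \<circ> f"
      using minus_one_subset h by (auto simp: fun_eq_iff linear_neg)
    moreover have "h \<in> carrier Aut_Leech" using h calculation minus_one_subset uminus_mem_Aut_Leech one_closed by auto
    ultimately have "f \<otimes>\<^bsub>Aut_Leech\<^esub> h \<otimes>\<^bsub>Aut_Leech\<^esub> inv\<^bsub>Aut_Leech\<^esub> f = h"
      using f m_assoc[of h f "inv\<^bsub>Aut_Leech\<^esub> f"] r_inv[OF f] r_one[of h] by simp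
    then show ?thesis using h by simp
  qed
  ultimately show ?thesis by (simp add: normal_inv_iff)
qed

abbreviation pm_class :: "(R24 \<Rightarrow> R24) \<Rightarrow> (R24 \<Rightarrow> R24) set" where
  "pm_class f \<equiv> minus_one #>\<^bsub>Aut_Leech\<^esub> f"

lemma group_Co1: "group Co1"
  unfolding Co1_def using minus_one_normal by (rule normal.factorgroup_is_group)

lemma pm_class_mem_Co1: "f \<in> carrier Aut_Leech \<Longrightarrow> pm_class f \<in> carrier Co1"
  unfolding Co1_def carrier_FactGroup by blast

lemma pm_class_mult:
  "f \<in> carrier Aut_Leech \<Longrightarrow> g \<in> carrier Aut_Leech \<Longrightarrow> pm_class f \<otimes>\<^bsub>Co1\<^esub> pm_class g = pm_class (f \<circ> g)"
  using normal.rcos_sum[OF minus_one_normal, of f g] by (simp add: Co1_def)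

lemma pm_class_id: "pm_class id = \<one>\<^bsub>Co1\<^esub>"
  unfolding Co1_def by (auto simp: r_coset_def)

lemma pm_class_eqD:
  assumes "f \<in> carrier Aut_Leech" "pm_class f = pm_class g"
  shows "f = g \<or> f = uminus \<circ> g"
proof -
  have "f \<in> pm_class f"
    using group.rcos_self[OF group_Aut_Leech assms(1)] minus_one_normal
    by (simp add: normal_imp_subgroup)
  then have "f \<in> pm_class g" by (simp add: assms(2))
  then obtain h where "h \<in> minus_one" "f = h \<circ> g" by (auto simp: r_coset_def)
  then show ?thesis using minus_one_subset by auto
qed

lemma Co2_in_Co1_subset: "Co2_in_Co1 v \<subseteq> carrier Co1"
  unfolding Co2_in_Co1_def Co2_def using pm_class_mem_Co1 by blast

lemma Co1_action_lcoset:
  assumes "x \<in> carrier Co1" "a \<in> carrier Co1"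
  shows "Co1_action x (a <#\<^bsub>Co1\<^esub> Co2_in_Co1 v) = (x \<otimes>\<^bsub>Co1\<^esub> a) <#\<^bsub>Co1\<^esub> Co2_in_Co1 v"
  unfolding Co1_action_def
  by (rule group.lcos_m_assoc[OF group_Co1 Co2_in_Co1_subset assms])

lemma Omega_cases:
  assumes "\<omega> \<in> Omega v"
  obtains a where "a \<in> carrier Co1" "\<omega> = a <#\<^bsub>Co1\<^esub> Co2_in_Co1 v"
  using assms by (auto simp: Omega_def LCOSETS_def)

lemma lcoset_mem_Omega: "a \<in> carrier Co1 \<Longrightarrow> a <#\<^bsub>Co1\<^esub> Co2_in_Co1 v \<in> Omega v"
  by (auto simp: Omega_def LCOSETS_def)

lemma Co1_action_mem:
  assumes "x \<in> carrier Co1" "\<omega> \<in> Omega v"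
  shows "Co1_action x \<omega> \<in> Omega v"
  using assms Co1_action_lcoset lcoset_mem_Omega group.is_monoid[OF group_Co1]
  by (metis Omega_cases monoid.m_closed)

lemma Co1_action_mult:
  assumes "x \<in> carrier Co1" "y \<in> carrier Co1" "\<omega> \<in> Omega v"
  shows "Co1_action x (Co1_action y \<omega>) = Co1_action (x \<otimes>\<^bsub>Co1\<^esub> y) \<omega>"
proof -
  interpret group Co1 by (rule group_Co1)
  obtain a where a: "a \<in> carrier Co1" "\<omega> = a <#\<^bsub>Co1\<^esub> Co2_in_Co1 v" using assms(3) by (rule Omega_cases)
  show ?thesis using assms(1,2) a by (simp add: Co1_action_lcoset m_assoc)
qed

lemma Co1_action_one:
  assumes "\<omega> \<in> Omega v"
  shows "Co1_action \<one>\<^bsub>Co1\<^esub> \<omega> = \<omega>"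
proof -
  interpret group Co1 by (rule group_Co1)
  obtain a where a: "a \<in> carrier Co1" "\<omega> = a <#\<^bsub>Co1\<^esub> Co2_in_Co1 v" using assms by (rule Omega_cases)
  show ?thesis using a by (simp add: Co1_action_lcoset)
qed

lemma Co1_action_transitive:
  assumes "\<omega> \<in> Omega v" "\<omega>' \<in> Omega v"
  shows "\<exists>g\<in>carrier Co1. Co1_action (inv\<^bsub>Co1\<^esub> g) \<omega> = \<omega>'"
proof -
  interpret group Co1 by (rule group_Co1)
  obtain a where a: "a \<in> carrier Co1" "\<omega> = a <#\<^bsub>Co1\<^esub> Co2_in_Co1 v" using assms(1) by (rule Omega_cases)
  obtain b where b: "b \<in> carrier Co1" "\<omega>' = b <#\<^bsub>Co1\<^esub> Co2_in_Co1 v" using assms(2) by (rule Omega_cases)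
  have "inv\<^bsub>Co1\<^esub> (a \<otimes>\<^bsub>Co1\<^esub> inv\<^bsub>Co1\<^esub> b) \<otimes>\<^bsub>Co1\<^esub> a = b"
    using a(1) b(1) by (simp add: inv_mult_group m_assoc)
  then show ?thesis using a b by (intro bexI[of _ "a \<otimes>\<^bsub>Co1\<^esub> inv\<^bsub>Co1\<^esub> b"]) (simp_all add: Co1_action_lcoset)
qed

text \<open>
  If \<open>\<epsilon>\<close> fixes the coset of \<open>\<gamma>\<close>, then
  \<open>\<epsilon> \<circ> \<gamma> = \<plusminus> \<gamma> \<circ> \<eta>\<close> for some
  \<open>\<eta>\<close> fixing \<open>v\<close>, so \<open>\<epsilon>\<close> maps the minimal
  vector \<open>\<gamma> v\<close> to itself or to its negative.
\<close>

lemma sign_changes_move_cosets: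
  assumes v: "v \<in> minimal_vectors leech_lattice" and \<omega>: "\<omega> \<in> Omega v"
  shows "\<exists>g. Co1_action (pm_class (sign_change (golay_generator g))) \<omega> \<noteq> \<omega>"
proof -
  interpret group Co1 by (rule group_Co1)
  obtain a where a: "a \<in> carrier Co1" "\<omega> = a <#\<^bsub>Co1\<^esub> Co2_in_Co1 v" using \<omega> by (rule Omega_cases)
  obtain \<gamma> where \<gamma>: "\<gamma> \<in> carrier Aut_Leech" "a = pm_class \<gamma>"
    using a(1) unfolding Co1_def carrier_FactGroup by blast
  obtain g where g: "sign_change (golay_generator g) (\<gamma> v) \<noteq> \<gamma> v" "sign_change (golay_generator g) (\<gamma> v) \<noteq> - \<gamma> v"
    using sign_change_moves_minimal_vector[OF minimal_vector_image[OF \<gamma>(1) v]] by blast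
  let ?\<epsilon> = "sign_change (golay_generator g)"
  have \<epsilon>: "?\<epsilon> \<in> carrier Aut_Leech" by (rule sign_change_mem_Aut_Leech[OF golay_generator_mem])
  have \<epsilon>\<gamma>: "?\<epsilon> \<circ> \<gamma> \<in> carrier Aut_Leech"
    using monoid.m_closed[OF group.is_monoid[OF group_Aut_Leech] \<epsilon> \<gamma>(1)] by simp
  have "Co1_action (pm_class ?\<epsilon>) \<omega> \<noteq> \<omega>"
  proof
    assume "Co1_action (pm_class ?\<epsilon>) \<omega> = \<omega>"
    then have eq: "pm_class (?\<epsilon> \<circ> \<gamma>) <#\<^bsub>Co1\<^esub> Co2_in_Co1 v = pm_class \<gamma> <#\<^bsub>Co1\<^esub> Co2_in_Co1 v"
      using a \<gamma> by (simp add: Co1_action_lcoset pm_class_mem_Co1[OF \<epsilon>] pm_class_mult[OF \<epsilon> \<gamma>(1)])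
    have "id \<in> Co2 v"
      using monoid.one_closed[OF group.is_monoid[OF group_Aut_Leech]] by (simp add: Co2_def)
    then have "\<one>\<^bsub>Co1\<^esub> \<in> Co2_in_Co1 v"
      unfolding Co2_in_Co1_def pm_class_id[symmetric] by blast
    then have "pm_class (?\<epsilon> \<circ> \<gamma>) \<otimes>\<^bsub>Co1\<^esub> \<one>\<^bsub>Co1\<^esub> \<in> pm_class (?\<epsilon> \<circ> \<gamma>) <#\<^bsub>Co1\<^esub> Co2_in_Co1 v"
      unfolding l_coset_def by blast
    then have "pm_class (?\<epsilon> \<circ> \<gamma>) \<in> pm_class \<gamma> <#\<^bsub>Co1\<^esub> Co2_in_Co1 v"
      using pm_class_mem_Co1[OF \<epsilon>\<gamma>] by (simp add: eq)
    then obtain \<eta> where \<eta>: "\<eta> \<in> Co2 v" "pm_class (?\<epsilon> \<circ> \<gamma>) = pm_class \<gamma> \<otimes>\<^bsub>Co1\<^esub> pm_class \<eta>"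
      unfolding l_coset_def Co2_in_Co1_def by blast
    then have "pm_class (?\<epsilon> \<circ> \<gamma>) = pm_class (\<gamma> \<circ> \<eta>)"
      using pm_class_mult[OF \<gamma>(1), of \<eta>] by (simp add: Co2_def)
    then have "?\<epsilon> \<circ> \<gamma> = \<gamma> \<circ> \<eta> \<or> ?\<epsilon> \<circ> \<gamma> = uminus \<circ> (\<gamma> \<circ> \<eta>)"
      by (rule pm_class_eqD[OF \<epsilon>\<gamma>])
    then have "?\<epsilon> (\<gamma> v) = \<gamma> (\<eta> v) \<or> ?\<epsilon> (\<gamma> v) = - \<gamma> (\<eta> v)"
      by (metis comp_apply)
    then show False using g \<eta>(1) by (simp add: Co2_def)
  qed
  then show ?thesis by blast
qed

lemma even_card_Omega:
  assumes v: "v \<in> minimal_vectors leech_lattice" and fin: "finite (Omega v)"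
  shows "even (card (Omega v))"
proof (rule even_card_if_no_common_fixed_point[OF fin])
  let ?e = "\<lambda>g. pm_class (sign_change (golay_generator g))"
  let ?F = "(\<lambda>g. Co1_action (?e g)) ` (UNIV :: PL23 set)"
  have A: "sign_change (golay_generator g) \<in> carrier Aut_Leech" for g
    by (rule sign_change_mem_Aut_Leech[OF golay_generator_mem])
  note e = pm_class_mem_Co1[OF A]
  have comm: "?e g \<otimes>\<^bsub>Co1\<^esub> ?e h = ?e h \<otimes>\<^bsub>Co1\<^esub> ?e g" for g h
    unfolding pm_class_mult[OF A A] by (simp add: fun_eq_iff comp_def sign_change_sign_change[of "golay_generator g"])
  have "sign_change S \<circ> sign_change S = id" for S
    by (simp add: fun_eq_iff sign_change_involution)
  then have sq: "?e g \<otimes>\<^bsub>Co1\<^esub> ?e g = \<one>\<^bsub>Co1\<^esub>" for g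
    unfolding pm_class_mult[OF A A] by (simp only: pm_class_id)
  show "finite ?F" by simp
  show "f \<omega> \<in> Omega v" if "f \<in> ?F" "\<omega> \<in> Omega v" for f \<omega>
    using that Co1_action_mem[OF e] by auto
  show "f (f \<omega>) = \<omega>" if "f \<in> ?F" "\<omega> \<in> Omega v" for f \<omega>
    using that by (auto simp: Co1_action_mult[OF e e] sq Co1_action_one)
  show "f (f' \<omega>) = f' (f \<omega>)" if F: "f \<in> ?F" "f' \<in> ?F" and \<omega>: "\<omega> \<in> Omega v" for f f' \<omega>
  proof -
    obtain g h where "f = Co1_action (?e g)" "f' = Co1_action (?e h)" using F by blast
    then show ?thesis using comm[of g h] \<omega> by (simp only: Co1_action_mult[OF e e])
  qed
  show "\<exists>f\<in>?F. f \<omega> \<noteq> \<omega>" if "\<omega> \<in> Omega v" for \<omega>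
    using sign_changes_move_cosets[OF v that] by auto
qed

section \<open>Codes with a transitive group\<close>

text \<open>
  This is what a transitive group of coordinate permutations that preserves the code provides;
  the injections \<open>\<phi>\<close> stand for the inverses of the group elements.
\<close>

definition homogeneous_code :: "'w set \<Rightarrow> ('w \<Rightarrow> bit) set \<Rightarrow> bool" where
  "homogeneous_code \<Omega> C \<longleftrightarrow> (\<forall>\<omega>\<in>\<Omega>. \<forall>\<omega>'\<in>\<Omega>. \<exists>\<phi>. inj_on \<phi> \<Omega> \<and> \<phi> ` \<Omega> \<subseteq> \<Omega> \<and> \<phi> \<omega> = \<omega>' \<and>
     (\<forall>c\<in>C. (\<lambda>x. if x \<in> \<Omega> then c (\<phi> x) else 0) \<in> C))"

lemma homogeneous_code_Omega:
  assumes "permutation_submodule Co1 Co1_action (Omega v) C"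
  shows "homogeneous_code (Omega v) C"
  unfolding homogeneous_code_def
proof (intro ballI)
  interpret group Co1 by (rule group_Co1)
  fix \<omega> \<omega>' assume "\<omega> \<in> Omega v" "\<omega>' \<in> Omega v"
  then obtain g where g: "g \<in> carrier Co1" "Co1_action (inv\<^bsub>Co1\<^esub> g) \<omega> = \<omega>'"
    using Co1_action_transitive by blast
  have "inj_on (Co1_action (inv\<^bsub>Co1\<^esub> g)) (Omega v)"
    by (rule inj_on_inverseI[of _ "Co1_action g"]) (use g(1) in \<open>simp add: Co1_action_mult Co1_action_one\<close>)
  moreover have "Co1_action (inv\<^bsub>Co1\<^esub> g) ` Omega v \<subseteq> Omega v"
    using g(1) Co1_action_mem by auto
  moreover have "\<forall>c\<in>C. (\<lambda>x. if x \<in> Omega v then c (Co1_action (inv\<^bsub>Co1\<^esub> g) x) else 0) \<in> C"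
    using assms g(1) unfolding permutation_submodule_def permute_word_def by blast
  ultimately show "\<exists>\<phi>. inj_on \<phi> (Omega v) \<and> \<phi> ` Omega v \<subseteq> Omega v \<and> \<phi> \<omega> = \<omega>' \<and>
      (\<forall>c\<in>C. (\<lambda>x. if x \<in> Omega v then c (\<phi> x) else 0) \<in> C)"
    using g(2) by blast
qed

lemma homogeneous_code_nonzero_coordinates:
  assumes "homogeneous_code \<Omega> C" "C \<subseteq> F2_space \<Omega>" "c \<in> C" "c \<noteq> 0" "\<omega> \<in> \<Omega>"
  shows "\<exists>c\<in>C. c \<omega> \<noteq> 0"
proof -
  obtain \<omega>' where "c \<omega>' \<noteq> 0" using assms(4) by (auto simp: fun_eq_iff)
  moreover from this have "\<omega>' \<in> \<Omega>" using assms(2,3) by (auto simp: F2_space_def)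
  then obtain \<phi> where "\<phi> \<omega> = \<omega>'" "(\<lambda>x. if x \<in> \<Omega> then c (\<phi> x) else 0) \<in> C"
    using assms(1,3,5) unfolding homogeneous_code_def by blast
  ultimately show ?thesis using assms(5) by (intro bexI[of _ "\<lambda>x. if x \<in> \<Omega> then c (\<phi> x) else 0"]) auto
qed

text \<open>
  An injection that preserves the code and maps \<open>\<omega>\<close> to
  \<open>\<omega>'\<close> maps the repetitions of \<open>\<omega>\<close> to repetitions of
  \<open>\<omega>'\<close>.
\<close>

lemma (in binary_code) homogeneous_card_repetitions:
  assumes "homogeneous_code \<Omega> C" "\<omega> \<in> \<Omega>" "\<omega>' \<in> \<Omega>"
  shows "card (repetitions \<omega>) = card (repetitions \<omega>')"
proof -
  have le: "card (repetitions \<omega>) \<le> card (repetitions \<omega>')" if \<omega>: "\<omega> \<in> \<Omega>" "\<omega>' \<in> \<Omega>" for \<omega> \<omega>'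
  proof -
    obtain \<phi> where \<phi>: "inj_on \<phi> \<Omega>" "\<phi> ` \<Omega> \<subseteq> \<Omega>" "\<phi> \<omega> = \<omega>'"
      "\<And>c. c \<in> C \<Longrightarrow> (\<lambda>x. if x \<in> \<Omega> then c (\<phi> x) else 0) \<in> C"
      using assms(1) \<omega> unfolding homogeneous_code_def by blast
    have "\<phi> x \<in> repetitions \<omega>'" if "x \<in> repetitions \<omega>" for x
    proof -
      have x: "x \<in> \<Omega>" "\<And>c. c \<in> C \<Longrightarrow> c \<omega> = c x" using that by (auto simp: repetitions_def)
      have "c \<omega>' = c (\<phi> x)" if "c \<in> C" for c
        using x(2)[OF \<phi>(4)[OF that]] x(1) \<omega>(1) \<phi>(3) by simp
      then show ?thesis using x(1) \<phi>(2) by (auto simp: repetitions_def)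
    qed
    then show ?thesis
      by (intro card_inj_on_le[of \<phi>] inj_on_subset[OF \<phi>(1)])
        (auto simp: repetitions_def finite_coordinates)
  qed
  show ?thesis by (intro le_antisym le assms)
qed

theorem lemma7p1:
  fixes v :: R24
    and C :: "((R24 \<Rightarrow> R24) set set \<Rightarrow> bit) set"
    and w1 w2 :: nat
  assumes "v \<in> minimal_vectors leech_lattice"
    and "permutation_submodule Co1 Co1_action (Omega v) C"
    and "F2_dim C = 24"
    and "two_weight_code C w1 w2"
    and "w1 = 47104" and "w2 = 49152"
  shows "strongly_regular (code_graph C w1) 16777216 98280 4600 552 \<and>
         has_spectrum (code_graph C w1) {(98280, 1), (4072, 98280), (-24, 16678935)} \<and>
         strongly_regular (complement_graph (code_graph C w1)) 16777216 16678935 16581206 16585256 \<and>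
         has_spectrum (complement_graph (code_graph C w1)) {(16678935, 1), (23, 16678935), (-4073, 98280)}"
proof -
  have sub: "F2_subspace C" and supp: "C \<subseteq> F2_space (Omega v)"
    using assms(2) by (auto simp: permutation_submodule_def)
  have finC: "finite C" and cardC: "card C = 16777216"
    using finite_card_F2_subspace[OF sub assms(3)] by simp_all
  note hom = homogeneous_code_Omega[OF assms(2)]
  obtain c0 where c0: "c0 \<in> C" "c0 \<noteq> 0"
  proof -
    have "\<not> C \<subseteq> {0}"
    proof
      assume "C \<subseteq> {0}"
      then have "card C \<le> card {0 :: (R24 \<Rightarrow> R24) set set \<Rightarrow> bit}" by (intro card_mono) auto
      then show False using cardC by simp
    qed
    then show ?thesis using that by blast
  qed
  note nonzero = homogeneous_code_nonzero_coordinates[OF hom supp c0]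
  have fin_supp: "finite {\<omega>. c \<omega> \<noteq> 0}" if "c \<in> C" for c
    using supp that by (auto simp: F2_space_def)
  \<comment> \<open>Every point of \<open>\<Omega>\<close> lies in the support of one of finitely many words.\<close>
  have "Omega v \<subseteq> (\<Union>c\<in>C. {\<omega>. c \<omega> \<noteq> 0})" using nonzero by auto
  then have finO: "finite (Omega v)" by (rule finite_subset) (use finC fin_supp in auto)
  interpret binary_code "Omega v" C
    by unfold_locales (use finO finC sub supp nonzero in auto)
  have tw: "weight c = w1 \<or> weight c = w2" if "c \<in> C" "c \<noteq> 0" for c
  proof -
    have "{\<omega>. c \<omega> \<noteq> 0} \<noteq> {}"
    proof
      assume "{\<omega>. c \<omega> \<noteq> 0} = {}"
      then have "c = 0" by (intro ext) auto
      then show False using that(2) by blast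
    qed
    then have "weight c \<noteq> 0" using fin_supp[OF that(1)] unfolding weight_def card_eq_0_iff by blast
    then have "weight c \<in> weight ` C - {0}" using that(1) by simp
    then have "weight c \<in> {w1, w2}" using assms(4) unfolding two_weight_code_def by blast
    then show ?thesis by blast
  qed
  have w: "w1 \<noteq> 0" "w1 \<noteq> w2" using assms(5,6) by auto
  obtain \<omega>0 where \<omega>0: "\<omega>0 \<in> Omega v"
    using c0 supp by (fastforce simp: F2_space_def fun_eq_iff)
  define n m a where "n = int (card (Omega v))" and "m = int (card (repetitions \<omega>0))"
    and "a = int (card {c \<in> C. weight c = w1})"
  have rep: "int (card (repetitions \<omega>)) = m" if "\<omega> \<in> Omega v" for \<omega>
    using homogeneous_card_repetitions[OF hom that \<omega>0] by (simp add: m_def)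
  have a1: "4096 * a = - 16777216 * (n - 98304) - 98304"
    using card_light_words[OF w tw] by (simp add: cardC assms(5,6) a_def n_def)
  \<comment> \<open>The zero word does not have weight \<open>w1\<close>, so the count stays below the size of the code.\<close>
  have "{c \<in> C. weight c = w1} \<subset> C"
    using zero_mem w(1) by (force simp: weight_def)
  then have "card {c \<in> C. weight c = w1} < card C" by (rule psubset_card_mono[OF finC])
  then have a2: "0 \<le> a" "a < 16777216" by (simp_all add: a_def cardC)
  have "(\<Sum>\<omega>\<in>Omega v. int (card (repetitions \<omega>))) = n * m"
    by (simp add: rep n_def)
  then have a3: "16777216 * (n * m) = (n - 98304)\<^sup>2 * 16777216
      + ((n - 94208)\<^sup>2 - (n - 98304)\<^sup>2) * a + n\<^sup>2 - (n - 98304)\<^sup>2"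
    using second_moment[OF w tw] by (simp add: cardC assms(5,6) a_def n_def)
  have "even n" using even_card_Omega[OF assms(1) finO] by (simp add: n_def)
  note len = length_from_moments[OF a1 a2 a3 this]
  have n: "card (Omega v) = 98280" and m: "\<And>\<omega>. \<omega> \<in> Omega v \<Longrightarrow> card (repetitions \<omega>) = 1"
    using len rep by (simp_all add: n_def)
  have a: "card {c \<in> C. weight c = w1} = 98280"
    using a1 len(1) by (simp add: a_def)
  \<comment> \<open>For words of weights \<open>w1\<close> and \<open>w2\<close> the coordinate sums are \<open>4072\<close> and \<open>-24\<close>.\<close>
  have com: "16777216 * int (common_words w1 d) = 16777216 * (coordinate_sum d + 576) - 196608 * (coordinate_sum d + 24)"
    if "d \<in> C" "d \<noteq> 0" for d
    using common_light_words[OF w tw m that] by (simp add: cardC assms(5,6) n)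
  have srg: "strongly_regular (code_graph C w1) 16777216 98280 4600 552"
    unfolding cardC[symmetric]
  proof (rule code_graph_strongly_regular[OF w(1) a])
    fix d assume d: "d \<in> C" "weight d = w1"
    then have "d \<noteq> 0" using w(1) by (auto simp: weight_def)
    then show "common_words w1 d = 4600"
      using com[OF d(1)] coordinate_sum_eq[OF d(1)] d(2) by (simp add: n assms(5))
  next
    fix d assume d: "d \<in> C" "d \<noteq> 0" "weight d \<noteq> w1"
    then show "common_words w1 d = 552"
      using com[OF d(1,2)] coordinate_sum_eq[OF d(1)] tw[OF d(1,2)] by (simp add: n assms(6))
  qed
  have csrg: "strongly_regular (complement_graph (code_graph C w1)) 16777216 16678935 16581206 16585256"
    using strongly_regular_complement[OF srg] by simp
  have "has_spectrum (code_graph C w1) {(of_nat 98280, 1), (of_int 4072, 98280), (of_int (-24), 16678935)}"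
    by (rule strongly_regular_has_spectrum[OF srg]) simp_all
  moreover have "has_spectrum (complement_graph (code_graph C w1))
      {(of_nat 16678935, 1), (of_int 23, 16678935), (of_int (-4073), 98280)}"
    by (rule strongly_regular_has_spectrum[OF csrg]) simp_all
  ultimately show ?thesis using srg csrg by simp
qed

end
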